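(* Let $\mathcal S$ be a finite simplicial poset with face ring $\mathbb Z[\mathcal S]$. Let $\mathbb Z[\cdot]_{\mathcal S}$ be the covariant functor from the opposite face category of $\mathcal S$ to the category of commutative associative graded rings with unit whose value on $\sigma\in\mathcal S$ is the polynomial ring $\mathbb Z[\sigma]=\mathbb Z[v_i: i\in V(\sigma)]$ ($\deg v_i=2$) and whose value on the morphism $\sigma\le\tau$ is the surjection $\mathbb Z[\tau]\to\mathbb Z[\sigma]$ sending each $v_i$ with $i\notin V(\sigma)$ to zero (and $v_i$ to $v_i$ for $i\in V(\sigma)$). Then $$\mathbb Z[\mathcal S]=\lim\mathbb Z[\cdot]_{\mathcal S},$$ where the (inverse) limit is taken in the category of commutative associative graded rings with unit.
   Context: Simplicial posets. A finite poset $\mathcal S$ is simplicial if it has an initial element $\hat 0$ and for each $\sigma\in\mathcal S$ the lower segment $[\hat 0,\sigma]$ is a boolean lattice (the face poset of a simplex). The rank $|\sigma|$ equals $k$ if $[\hat 0,\sigma]$ is the face poset of a $(k-1)$-dimensional simplex. Vertices are the elements of rank one, identified with $[m]=\{1,\ldots,m\}$; $V(\sigma)=\{i\in[m]: i\le\sigma\}$. For $\sigma,\tau\in\mathcal S$, $\sigma\vee\tau$ denotes the set of their least (i.e. minimal) common upper bounds, and $\sigma\wedge\tau$ the set of their greatest common lower bounds, which is a single element whenever $\sigma\vee\tau\neq\varnothing$. The face category of $\mathcal S$ has as objects the elements of $\mathcal S$ (including $\hat 0$) and one morphism from $\sigma$ to $\tau$ whenever $\sigma\le\tau$. Face ring.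 $\mathbb Z[\mathcal S]=\mathbb Z[v_\sigma:\sigma\in\mathcal S]/\mathcal I_{\mathcal S}$, with $\deg v_\sigma=2|\sigma|$, where $\mathcal I_{\mathcal S}$ is generated by $v_{\hat 0}-1$ and all elements $v_\sigma v_\tau-v_{\sigma\wedge\tau}\cdot\sum_{\eta\in\sigma\vee\tau}v_\eta$ (the empty sum is zero, so $v_\sigma v_\tau=0$ if $\sigma\vee\tau=\varnothing$). *)

theory Defs
  imports "HOL-Algebra.QuotRing" "HOL-Algebra.Complete_Lattice" "HOL-Library.Poly_Mapping"
begin

section \<open>Simplicial posets\<close>

text \<open>The face poset of a simplex with \<open>k\<close> vertices (the empty face included) is the poset of
  all subsets of a \<open>k\<close>-element set.\<close>

definition simplex_segment :: "('a, 'b) gorder_scheme \<Rightarrow> 'a \<Rightarrow> nat \<Rightarrow> bool" where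
  "simplex_segment S \<sigma> k \<longleftrightarrow>
     (\<exists>\<phi>. bij_betw \<phi> \<lbrace>\<bottom>\<^bsub>S\<^esub>..\<sigma>\<rbrace>\<^bsub>S\<^esub> (Pow {..<k}) \<and>
          (\<forall>x \<in> \<lbrace>\<bottom>\<^bsub>S\<^esub>..\<sigma>\<rbrace>\<^bsub>S\<^esub>. \<forall>y \<in> \<lbrace>\<bottom>\<^bsub>S\<^esub>..\<sigma>\<rbrace>\<^bsub>S\<^esub>.
             x \<sqsubseteq>\<^bsub>S\<^esub> y \<longleftrightarrow> \<phi> x \<subseteq> \<phi> y))"

locale simplicial_poset = partial_order S + weak_partial_order_bottom S for S (structure) +
  assumes finite_carrier: "finite (carrier S)"
    and boolean_segments: "\<sigma> \<in> carrier S \<Longrightarrow> \<exists>k. simplex_segment S \<sigma> k"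

definition rank :: "('a, 'b) gorder_scheme \<Rightarrow> 'a \<Rightarrow> nat" where
  "rank S \<sigma> = (THE k. simplex_segment S \<sigma> k)"

definition vertices :: "('a, 'b) gorder_scheme \<Rightarrow> 'a \<Rightarrow> 'a set" where
  "vertices S \<sigma> = {i \<in> carrier S. rank S i = 1 \<and> i \<sqsubseteq>\<^bsub>S\<^esub> \<sigma>}"

text \<open>Least common upper bounds and greatest common lower bounds are minimal and maximal elements
  here; neither need be unique.\<close>

definition joins :: "('a, 'b) gorder_scheme \<Rightarrow> 'a \<Rightarrow> 'a \<Rightarrow> 'a set" where
  "joins S \<sigma> \<tau> = {\<eta> \<in> Upper S {\<sigma>, \<tau>}. \<forall>\<zeta> \<in> Upper S {\<sigma>, \<tau>}. \<zeta> \<sqsubseteq>\<^bsub>S\<^esub> \<eta> \<longrightarrow> \<zeta> = \<eta>}"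

definition meets :: "('a, 'b) gorder_scheme \<Rightarrow> 'a \<Rightarrow> 'a \<Rightarrow> 'a set" where
  "meets S \<sigma> \<tau> = {\<eta> \<in> Lower S {\<sigma>, \<tau>}. \<forall>\<zeta> \<in> Lower S {\<sigma>, \<tau>}. \<eta> \<sqsubseteq>\<^bsub>S\<^esub> \<zeta> \<longrightarrow> \<zeta> = \<eta>}"


section \<open>Commutative graded rings\<close>

record 'a graded_ring = "'a ring" +
  piece :: "int \<Rightarrow> 'a set"

text \<open>Grading by the integers. Rings graded by the natural numbers are those whose pieces of negative
  degree vanish. Commutativity is strict (no signs).\<close>

definition is_graded_ring :: "'a graded_ring \<Rightarrow> bool" where
  "is_graded_ring R \<longleftrightarrow>
     cring R \<and>
     (\<forall>d. additive_subgroup (piece R d) R) \<and>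
     (\<forall>x \<in> carrier R. \<exists>!f. (\<forall>d. f d \<in> piece R d) \<and> finite {d. f d \<noteq> \<zero>\<^bsub>R\<^esub>} \<and>
        x = finsum R f {d. f d \<noteq> \<zero>\<^bsub>R\<^esub>}) \<and>
     \<one>\<^bsub>R\<^esub> \<in> piece R 0 \<and>
     (\<forall>d e. \<forall>x \<in> piece R d. \<forall>y \<in> piece R e. x \<otimes>\<^bsub>R\<^esub> y \<in> piece R (d + e))"

definition graded_hom :: "'a graded_ring \<Rightarrow> 'b graded_ring \<Rightarrow> ('a \<Rightarrow> 'b) set" where
  "graded_hom R R' = {h \<in> ring_hom R R'. \<forall>d. h ` piece R d \<subseteq> piece R' d}"


section \<open>Limits of functors on the opposite of a poset category\<close>

text \<open>A functor is given by its values \<open>F \<sigma>\<close> on objects and \<open>r \<sigma> \<tau> : F \<tau> \<rightarrow> F \<sigma>\<close> on the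
  morphism \<open>\<sigma> \<le> \<tau>\<close>.\<close>

definition graded_functor ::
  "('i, 'j) gorder_scheme \<Rightarrow> ('i \<Rightarrow> 'a graded_ring) \<Rightarrow> ('i \<Rightarrow> 'i \<Rightarrow> 'a \<Rightarrow> 'a) \<Rightarrow> bool" where
  "graded_functor S F r \<longleftrightarrow>
     (\<forall>\<sigma> \<in> carrier S. is_graded_ring (F \<sigma>)) \<and>
     (\<forall>\<sigma> \<in> carrier S. \<forall>\<tau> \<in> carrier S. \<sigma> \<sqsubseteq>\<^bsub>S\<^esub> \<tau> \<longrightarrow> r \<sigma> \<tau> \<in> graded_hom (F \<tau>) (F \<sigma>)) \<and>
     (\<forall>\<sigma> \<in> carrier S. \<forall>x \<in> carrier (F \<sigma>). r \<sigma> \<sigma> x = x) \<and>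
     (\<forall>\<rho> \<in> carrier S. \<forall>\<sigma> \<in> carrier S. \<forall>\<tau> \<in> carrier S. \<rho> \<sqsubseteq>\<^bsub>S\<^esub> \<sigma> \<and> \<sigma> \<sqsubseteq>\<^bsub>S\<^esub> \<tau> \<longrightarrow>
        (\<forall>x \<in> carrier (F \<tau>). r \<rho> \<sigma> (r \<sigma> \<tau> x) = r \<rho> \<tau> x))"

definition graded_cone ::
  "('i, 'j) gorder_scheme \<Rightarrow> ('i \<Rightarrow> 'a graded_ring) \<Rightarrow> ('i \<Rightarrow> 'i \<Rightarrow> 'a \<Rightarrow> 'a) \<Rightarrow>
   'c graded_ring \<Rightarrow> ('i \<Rightarrow> 'c \<Rightarrow> 'a) \<Rightarrow> bool" where
  "graded_cone S F r R q \<longleftrightarrow>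
     is_graded_ring R \<and>
     (\<forall>\<sigma> \<in> carrier S. q \<sigma> \<in> graded_hom R (F \<sigma>)) \<and>
     (\<forall>\<sigma> \<in> carrier S. \<forall>\<tau> \<in> carrier S. \<sigma> \<sqsubseteq>\<^bsub>S\<^esub> \<tau> \<longrightarrow>
        (\<forall>x \<in> carrier R. r \<sigma> \<tau> (q \<tau> x) = q \<sigma> x))"

text \<open>The universal property of a limit. It quantifies over all graded rings, so the type \<open>'t\<close> of
  their elements is a parameter; a limit is a cone satisfying this for every type \<open>'t\<close>.\<close>

definition is_graded_limit ::
  "'t itself \<Rightarrow> ('i, 'j) gorder_scheme \<Rightarrow> ('i \<Rightarrow> 'a graded_ring) \<Rightarrow> ('i \<Rightarrow> 'i \<Rightarrow> 'a \<Rightarrow> 'a) \<Rightarrow>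
   'c graded_ring \<Rightarrow> ('i \<Rightarrow> 'c \<Rightarrow> 'a) \<Rightarrow> bool" where
  "is_graded_limit (_ :: 't itself) S F r L p \<longleftrightarrow>
     graded_functor S F r \<and> graded_cone S F r L p \<and>
     (\<forall>(R :: 't graded_ring) q. graded_cone S F r R q \<longrightarrow>
        (\<exists>!u. u \<in> graded_hom R L \<inter> extensional (carrier R) \<and>
           (\<forall>\<sigma> \<in> carrier S. \<forall>x \<in> carrier R. p \<sigma> (u x) = q \<sigma> x)))"


section \<open>Polynomial rings\<close>

type_synonym 'x int_poly = "('x \<Rightarrow>\<^sub>0 nat) \<Rightarrow>\<^sub>0 int"

definition var :: "'x \<Rightarrow> 'x int_poly" where
  "var x = Poly_Mapping.single (Poly_Mapping.single x 1) 1"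

definition weighted_degree :: "('x \<Rightarrow> nat) \<Rightarrow> ('x \<Rightarrow>\<^sub>0 nat) \<Rightarrow> nat" where
  "weighted_degree w m = (\<Sum>x \<in> Poly_Mapping.keys m. w x * Poly_Mapping.lookup m x)"

text \<open>Integer polynomials in the variables from \<open>X\<close>, the variable \<open>x\<close> having degree \<open>w x\<close>.\<close>

definition int_poly_ring :: "'x set \<Rightarrow> ('x \<Rightarrow> nat) \<Rightarrow> 'x int_poly graded_ring" where
  "int_poly_ring X w =
     \<lparr>carrier = {f. \<forall>m \<in> Poly_Mapping.keys f. Poly_Mapping.keys m \<subseteq> X},
      mult = (*), one = 1, zero = 0, add = (+),
      piece = (\<lambda>d. {f. \<forall>m \<in> Poly_Mapping.keys f.
                       Poly_Mapping.keys m \<subseteq> X \<and> int (weighted_degree w m) = d})\<rparr>"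

text \<open>The ring homomorphism sending each variable \<open>x\<close> to \<open>g x\<close>.\<close>

definition poly_subst :: "('x \<Rightarrow> 'y int_poly) \<Rightarrow> 'x int_poly \<Rightarrow> 'y int_poly" where
  "poly_subst g f =
     (\<Sum>m \<in> Poly_Mapping.keys f. of_int (Poly_Mapping.lookup f m) *
        (\<Prod>x \<in> Poly_Mapping.keys m. g x ^ Poly_Mapping.lookup m x))"


section \<open>The face ring and the functor on the face category\<close>

definition face_poly_ring :: "('a, 'b) gorder_scheme \<Rightarrow> 'a int_poly graded_ring" where
  "face_poly_ring S = int_poly_ring (carrier S) (\<lambda>\<sigma>. 2 * rank S \<sigma>)"

text \<open>If \<open>joins S \<sigma> \<tau>\<close> is empty, the sum and hence the product is zero, so that the value of
  \<open>the_elem (meets S \<sigma> \<tau>)\<close> is irrelevant; otherwise \<open>meets S \<sigma> \<tau>\<close> is a singleton.\<close>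

definition face_relations :: "('a, 'b) gorder_scheme \<Rightarrow> 'a int_poly set" where
  "face_relations S =
     {var \<bottom>\<^bsub>S\<^esub> - 1} \<union>
     {var \<sigma> * var \<tau> - var (the_elem (meets S \<sigma> \<tau>)) * (\<Sum>\<eta> \<in> joins S \<sigma> \<tau>. var \<eta>) | \<sigma> \<tau>.
        \<sigma> \<in> carrier S \<and> \<tau> \<in> carrier S}"

definition face_ideal :: "('a, 'b) gorder_scheme \<Rightarrow> 'a int_poly set" where
  "face_ideal S = genideal (face_poly_ring S) (face_relations S)"

definition face_ring :: "('a, 'b) gorder_scheme \<Rightarrow> 'a int_poly set graded_ring" where
  "face_ring S =
     ring.extend (face_poly_ring S Quot face_ideal S)
       \<lparr>piece = (\<lambda>d. (\<lambda>f. face_ideal S +>\<^bsub>face_poly_ring S\<^esub> f) ` piece (face_poly_ring S) d)\<rparr>"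

definition simplex_poly_ring :: "('a, 'b) gorder_scheme \<Rightarrow> 'a \<Rightarrow> 'a int_poly graded_ring" where
  "simplex_poly_ring S \<sigma> = int_poly_ring (vertices S \<sigma>) (\<lambda>_. 2)"

definition simplex_poly_restrict ::
  "('a, 'b) gorder_scheme \<Rightarrow> 'a \<Rightarrow> 'a \<Rightarrow> 'a int_poly \<Rightarrow> 'a int_poly" where
  "simplex_poly_restrict S \<sigma> \<tau> = poly_subst (\<lambda>i. if i \<in> vertices S \<sigma> then var i else 0)"

text \<open>The canonical map from the face ring to the polynomial ring of \<open>\<sigma>\<close>: it is induced by sending
  \<open>v\<^sub>\<tau>\<close> to the product of the vertices of \<open>\<tau>\<close> if \<open>\<tau> \<le> \<sigma>\<close>, and to zero otherwise. On a coset it is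
  the common value of its representatives.\<close>

definition face_ring_proj ::
  "('a, 'b) gorder_scheme \<Rightarrow> 'a \<Rightarrow> 'a int_poly set \<Rightarrow> 'a int_poly" where
  "face_ring_proj S \<sigma> A =
     the_elem (poly_subst (\<lambda>\<tau>. if \<tau> \<sqsubseteq>\<^bsub>S\<^esub> \<sigma> then \<Prod>i \<in> vertices S \<tau>. var i else 0) ` A)"

end

theory Submission
  imports Defs
begin

text \<open>
  A compatible family \<open>(f\<^sub>\<sigma>)\<close> is determined by the coefficients, for all faces \<open>\<sigma>\<close>, of the monomials of
  \<open>f\<^sub>\<sigma>\<close> in which every vertex of \<open>\<sigma>\<close> occurs: any other monomial of \<open>f\<^sub>\<sigma>\<close> has as its support a unique
  smaller face \<open>\<tau>\<close>, and its coefficient can be read off from \<open>f\<^sub>\<tau>\<close>. These coefficients are arbitrary, so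
  the limit is a free abelian group on the pairs of a face \<open>\<sigma>\<close> and a monomial with support \<open>\<sigma>\<close>.

  The face ring has the matching basis of face monomials \<open>v\<^sub>\<sigma> \<Prod> v\<^sub>i\<^sup>b\<close>, where \<open>i\<close> runs through the vertices
  of \<open>\<sigma>\<close> and the exponents \<open>b\<close> depend on \<open>i\<close>. Its image in the polynomial ring of \<open>\<rho>\<close> is the monomial on
  \<open>\<sigma>\<close> with exponents \<open>b + 1\<close> if \<open>\<sigma> \<le> \<rho>\<close>, and zero otherwise. Hence every compatible family is the image
  of a combination of face monomials (\<open>face_section\<close>), and the representation of an element by face
  monomials can be recovered from its images.

  The face monomials span the face ring (\<open>straightening\<close>) because \<open>v\<^sub>\<eta> v\<^sub>\<zeta> = v\<^sub>\<eta> \<Prod> v\<^sub>i\<close> for a face \<open>\<zeta>\<close> of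
  \<open>\<eta>\<close> with vertices \<open>i\<close> (\<open>var_mult_face_cong\<close>). With the relation for \<open>v\<^sub>\<tau> v\<^sub>\<sigma>\<close> this turns \<open>v\<^sub>\<tau>\<close> times a
  face monomial of \<open>\<sigma>\<close> into a sum of face monomials of the joins of \<open>\<tau>\<close> and \<open>\<sigma>\<close>.

  It follows that the projections to the polynomial rings are jointly injective
  (\<open>face_ring_proj_inject\<close>). The grading of the face ring and the universal property are deduced from
  this by comparison in the polynomial rings.\<close>

abbreviation "keys \<equiv> Poly_Mapping.keys"
abbreviation "lookup \<equiv> Poly_Mapping.lookup"
abbreviation "single \<equiv> Poly_Mapping.single"

section \<open>Integer polynomials\<close>

text \<open>Substitution, the extraction of homogeneous components and the map \<open>face_section\<close> below are all
  given by prescribing the images of the monomials.\<close>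

definition lin_ext :: "('k \<Rightarrow> 'b::comm_ring_1) \<Rightarrow> ('k \<Rightarrow>\<^sub>0 int) \<Rightarrow> 'b" where
  "lin_ext h f = (\<Sum>m \<in> keys f. of_int (lookup f m) * h m)"

lemma lin_ext_superset:
  assumes "finite A" "keys f \<subseteq> A"
  shows "lin_ext h f = (\<Sum>m \<in> A. of_int (lookup f m) * h m)"
  unfolding lin_ext_def using assms by (intro sum.mono_neutral_left) (auto simp: in_keys_iff)

lemma lin_ext_add: "lin_ext h (f + g) = lin_ext h f + lin_ext h g"
proof -
  have "lin_ext h x = (\<Sum>m \<in> keys f \<union> keys g. of_int (lookup x m) * h m)"
    if "x \<in> {f, g, f + g}" for x
    using that keys_add[of f g] by (intro lin_ext_superset) auto
  then show ?thesis
    by (simp add: lookup_add algebra_simps sum.distrib)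
qed

lemma lin_ext_zero [simp]: "lin_ext h 0 = 0"
  by (simp add: lin_ext_def)

lemma lin_ext_single [simp]: "lin_ext h (single m c) = of_int c * h m"
  by (simp add: lin_ext_def)

lemma lin_ext_uminus: "lin_ext h (- f) = - lin_ext h f"
  using lin_ext_add[of h f "- f"] by (simp add: eq_neg_iff_add_eq_0 add.commute)

lemma lin_ext_diff: "lin_ext h (f - g) = lin_ext h f - lin_ext h g"
  using lin_ext_add[of h f "- g"] by (simp add: lin_ext_uminus)

lemma lin_ext_sum: "lin_ext h (sum f A) = (\<Sum>x\<in>A. lin_ext h (f x))"
  by (induction A rule: infinite_finite_induct) (simp_all add: lin_ext_add)

lemma sum_single_keys: "(\<Sum>m\<in>keys f. single m (lookup f m)) = f"
  for f :: "'k \<Rightarrow>\<^sub>0 'b::comm_monoid_add"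
  by (rule poly_mapping_eqI) (simp add: lookup_sum lookup_single when_def in_keys_iff)

lemma poly_mapping_additive_induct [case_names single add]:
  fixes f :: "'k \<Rightarrow>\<^sub>0 int"
  assumes single: "\<And>m c. m \<in> keys f \<Longrightarrow> P (single m c)"
    and add: "\<And>g h. P g \<Longrightarrow> P h \<Longrightarrow> P (g + h)" and zero: "P 0"
  shows "P f"
proof -
  have "P (\<Sum>m\<in>A. single m (lookup f m))" if "A \<subseteq> keys f" for A
    using finite_subset[OF that finite_keys] that
    by (induction rule: finite_induct) (auto intro: add single zero)
  from this[of "keys f"] show ?thesis
    by (simp add: sum_single_keys)
qed

lemma lookup_sum_single:
  "finite A \<Longrightarrow> lookup (\<Sum>i\<in>A. single i (n i)) j = (if j \<in> A then n j else 0)"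
  by (simp add: lookup_sum lookup_single when_def)

definition monom_val :: "('x \<Rightarrow> 'b::comm_monoid_mult) \<Rightarrow> ('x \<Rightarrow>\<^sub>0 nat) \<Rightarrow> 'b" where
  "monom_val g m = (\<Prod>x \<in> keys m. g x ^ lookup m x)"

lemma monom_val_superset:
  assumes "finite A" "keys m \<subseteq> A"
  shows "monom_val g m = (\<Prod>x \<in> A. g x ^ lookup m x)"
  unfolding monom_val_def using assms by (intro prod.mono_neutral_left) (auto simp: in_keys_iff)

lemma monom_val_zero [simp]: "monom_val g 0 = 1"
  by (simp add: monom_val_def)

lemma monom_val_add: "monom_val g (m + n) = monom_val g m * monom_val g n"
proof -
  have "monom_val g x = (\<Prod>i \<in> keys m \<union> keys n. g i ^ lookup x i)"
    if "x \<in> {m, n, m + n}" for x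
    using that keys_add[of m n] by (intro monom_val_superset) auto
  then show ?thesis
    by (simp add: lookup_add power_add prod.distrib)
qed

lemma monom_val_single [simp]: "monom_val g (single x k) = g x ^ k"
  by (simp add: monom_val_def)

lemma poly_subst_lin_ext: "poly_subst g = lin_ext (monom_val g)"
  by (rule ext) (simp add: poly_subst_def lin_ext_def monom_val_def)

lemma poly_subst_add: "poly_subst g (f + h) = poly_subst g f + poly_subst g h"
  by (simp add: poly_subst_lin_ext lin_ext_add)

lemma poly_subst_diff: "poly_subst g (f - h) = poly_subst g f - poly_subst g h"
  by (simp add: poly_subst_lin_ext lin_ext_diff)

lemma poly_subst_sum: "poly_subst g (sum f A) = (\<Sum>x\<in>A. poly_subst g (f x))"
  by (simp add: poly_subst_lin_ext lin_ext_sum)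

lemma poly_subst_zero [simp]: "poly_subst g 0 = 0"
  by (simp add: poly_subst_lin_ext)

lemma poly_subst_single: "poly_subst g (single m c) = of_int c * monom_val g m"
  by (simp add: poly_subst_lin_ext)

lemma poly_subst_of_int [simp]: "poly_subst g (of_int c) = of_int c"
  using poly_subst_single[of g 0 c] by (simp flip: single_of_int)

lemma poly_subst_one [simp]: "poly_subst g 1 = 1"
  using poly_subst_of_int[of g 1] by simp

lemma poly_subst_var [simp]: "poly_subst g (var x) = g x"
  by (simp add: var_def poly_subst_single)

lemma poly_subst_mult: "poly_subst g (f * h) = poly_subst g f * poly_subst g h"
proof (induction f rule: poly_mapping_additive_induct)
  case (single m c)
  show ?case
    by (induction h rule: poly_mapping_additive_induct)
      (simp_all add: mult_single poly_subst_single monom_val_add poly_subst_add algebra_simps)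
qed (simp_all add: poly_subst_add algebra_simps)

lemma poly_subst_lin_ext_comp:
  "poly_subst g (lin_ext h f) = lin_ext (\<lambda>m. poly_subst g (h m)) f"
  by (simp add: lin_ext_def poly_subst_sum poly_subst_mult)

lemma poly_subst_power: "poly_subst g (f ^ n) = poly_subst g f ^ n"
  by (induction n) (simp_all add: poly_subst_mult)

lemma poly_subst_prod: "poly_subst g (prod f A) = (\<Prod>x\<in>A. poly_subst g (f x))"
  by (induction A rule: infinite_finite_induct) (simp_all add: poly_subst_mult)

lemma poly_subst_compose:
  "poly_subst g (poly_subst h f) = poly_subst (\<lambda>x. poly_subst g (h x)) f"
  by (simp add: poly_subst_def[of h] poly_subst_def[of _ f] poly_subst_sum poly_subst_mult
      poly_subst_prod poly_subst_power)

lemma poly_subst_cong: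
  assumes "\<And>m x. m \<in> keys f \<Longrightarrow> x \<in> keys m \<Longrightarrow> g x = h x"
  shows "poly_subst g f = poly_subst h f"
  using assms unfolding poly_subst_def by (intro sum.cong prod.cong arg_cong2[of _ _ _ _ "(*)"]) auto

lemma var_power: "var x ^ k = single (single x k) (1::int)"
  by (induction k) (simp_all add: var_def mult_single flip: single_add)

lemma prod_single_one:
  "(\<Prod>x\<in>A. single (n x) (1::int)) = single (\<Sum>x\<in>A. n x) 1" for n :: "'x \<Rightarrow> 'y \<Rightarrow>\<^sub>0 nat"
  by (induction A rule: infinite_finite_induct) (simp_all add: mult_single)

lemma single_eq_monom_val_var: "single m c = of_int c * monom_val var m"
proof -
  have "monom_val var m = single m (1::int)"
    by (simp add: monom_val_def var_power prod_single_one sum_single_keys)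
  then show ?thesis
    by (simp add: mult_single flip: single_of_int)
qed

section \<open>Graded polynomial rings\<close>

lemma weighted_degree_add:
  "weighted_degree w (m + n) = weighted_degree w m + weighted_degree w n"
proof -
  have "weighted_degree w x = (\<Sum>i \<in> keys m \<union> keys n. w i * lookup x i)"
    if "x \<in> {m, n, m + n}" for x
    unfolding weighted_degree_def using that keys_add[of m n]
    by (intro sum.mono_neutral_left) (auto simp: in_keys_iff)
  then show ?thesis
    by (simp add: lookup_add algebra_simps sum.distrib)
qed

lemma carrier_int_poly_ring:
  "f \<in> carrier (int_poly_ring X w) \<longleftrightarrow> (\<forall>m\<in>keys f. keys m \<subseteq> X)"
  by (simp add: int_poly_ring_def)

lemma piece_int_poly_ring:
  "f \<in> piece (int_poly_ring X w) d \<longleftrightarrow>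
     (\<forall>m\<in>keys f. keys m \<subseteq> X \<and> int (weighted_degree w m) = d)"
  by (simp add: int_poly_ring_def)

lemma int_poly_ring_ops [simp]:
  "x \<otimes>\<^bsub>int_poly_ring X w\<^esub> y = x * y" "x \<oplus>\<^bsub>int_poly_ring X w\<^esub> y = x + y"
  "\<one>\<^bsub>int_poly_ring X w\<^esub> = 1" "\<zero>\<^bsub>int_poly_ring X w\<^esub> = 0"
  by (simp_all add: int_poly_ring_def)

lemma piece_subset_carrier: "piece (int_poly_ring X w) d \<subseteq> carrier (int_poly_ring X w)"
  by (auto simp: piece_int_poly_ring carrier_int_poly_ring)

lemma piece_add:
  "f \<in> piece (int_poly_ring X w) d \<Longrightarrow> g \<in> piece (int_poly_ring X w) d \<Longrightarrow>
    f + g \<in> piece (int_poly_ring X w) d"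
  using keys_add[of f g] by (fastforce simp: piece_int_poly_ring)

lemma piece_zero: "0 \<in> piece (int_poly_ring X w) d"
  by (simp add: piece_int_poly_ring)

lemma piece_uminus: "f \<in> piece (int_poly_ring X w) d \<Longrightarrow> - f \<in> piece (int_poly_ring X w) d"
  by (simp add: piece_int_poly_ring in_keys_iff)

lemma piece_mult:
  "f \<in> piece (int_poly_ring X w) d \<Longrightarrow> g \<in> piece (int_poly_ring X w) e \<Longrightarrow>
    f * g \<in> piece (int_poly_ring X w) (d + e)"
  by (auto simp: piece_int_poly_ring weighted_degree_add dest!: keys_mult[THEN subsetD]
      keys_add[THEN subsetD])

lemma piece_of_int: "of_int c \<in> piece (int_poly_ring X w) 0"
proof -
  have "single 0 c \<in> piece (int_poly_ring X w) 0"
    by (simp add: piece_int_poly_ring weighted_degree_def)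
  then show ?thesis
    by (simp flip: single_of_int)
qed

lemma piece_one: "1 \<in> piece (int_poly_ring X w) 0"
  using piece_of_int[of 1] by simp

lemma piece_var: "x \<in> X \<Longrightarrow> int (w x) = d \<Longrightarrow> var x \<in> piece (int_poly_ring X w) d"
  by (simp add: piece_int_poly_ring weighted_degree_def var_def)

lemma piece_scale:
  "f \<in> piece (int_poly_ring X w) d \<Longrightarrow> of_int c * f \<in> piece (int_poly_ring X w) d"
  using piece_mult[OF piece_of_int] by simp

lemma piece_sum:
  "(\<And>x. x \<in> A \<Longrightarrow> f x \<in> piece (int_poly_ring X w) d) \<Longrightarrow> sum f A \<in> piece (int_poly_ring X w) d"
  by (induction A rule: infinite_finite_induct) (auto intro: piece_zero piece_add)

lemma piece_power:
  "f \<in> piece (int_poly_ring X w) d \<Longrightarrow> f ^ n \<in> piece (int_poly_ring X w) (int n * d)"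
  by (induction n) (auto simp: piece_one algebra_simps intro: piece_mult)

lemma piece_prod:
  "finite A \<Longrightarrow> (\<And>x. x \<in> A \<Longrightarrow> f x \<in> piece (int_poly_ring X w) (d x)) \<Longrightarrow>
    prod f A \<in> piece (int_poly_ring X w) (sum d A)"
  by (induction A rule: finite_induct) (auto intro: piece_one piece_mult)

lemma carrier_add:
  "f \<in> carrier (int_poly_ring X w) \<Longrightarrow> g \<in> carrier (int_poly_ring X w) \<Longrightarrow>
    f + g \<in> carrier (int_poly_ring X w)"
  using keys_add[of f g] by (fastforce simp: carrier_int_poly_ring)

lemma carrier_mult:
  "f \<in> carrier (int_poly_ring X w) \<Longrightarrow> g \<in> carrier (int_poly_ring X w) \<Longrightarrow>
    f * g \<in> carrier (int_poly_ring X w)"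
  by (fastforce simp: carrier_int_poly_ring dest!: keys_mult[THEN subsetD] keys_add[THEN subsetD])

lemma carrier_uminus: "f \<in> carrier (int_poly_ring X w) \<Longrightarrow> - f \<in> carrier (int_poly_ring X w)"
  by (simp add: carrier_int_poly_ring in_keys_iff)

lemma carrier_diff:
  "f \<in> carrier (int_poly_ring X w) \<Longrightarrow> g \<in> carrier (int_poly_ring X w) \<Longrightarrow>
    f - g \<in> carrier (int_poly_ring X w)"
  using carrier_add[where g = "- g", OF _ carrier_uminus] by simp

lemma carrier_zero: "0 \<in> carrier (int_poly_ring X w)"
  by (simp add: carrier_int_poly_ring)

lemma carrier_one: "1 \<in> carrier (int_poly_ring X w)"
  by (simp add: carrier_int_poly_ring)

lemma carrier_of_int: "of_int c \<in> carrier (int_poly_ring X w)"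
  using piece_of_int piece_subset_carrier by blast

lemma carrier_var: "x \<in> X \<Longrightarrow> var x \<in> carrier (int_poly_ring X w)"
  by (simp add: carrier_int_poly_ring var_def)

lemma carrier_power: "f \<in> carrier (int_poly_ring X w) \<Longrightarrow> f ^ n \<in> carrier (int_poly_ring X w)"
  by (induction n) (simp_all add: carrier_one carrier_mult)

lemma carrier_sum:
  "(\<And>x. x \<in> A \<Longrightarrow> f x \<in> carrier (int_poly_ring X w)) \<Longrightarrow> sum f A \<in> carrier (int_poly_ring X w)"
  by (induction A rule: infinite_finite_induct) (simp_all add: carrier_zero carrier_add)

lemma carrier_prod:
  "(\<And>x. x \<in> A \<Longrightarrow> f x \<in> carrier (int_poly_ring X w)) \<Longrightarrow> prod f A \<in> carrier (int_poly_ring X w)"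
  by (induction A rule: infinite_finite_induct) (simp_all add: carrier_one carrier_mult)

lemmas carrier_intros = carrier_add carrier_mult carrier_uminus carrier_diff carrier_zero
  carrier_one carrier_of_int carrier_var carrier_power carrier_sum carrier_prod

lemma cring_int_poly_ring: "cring (int_poly_ring X w)"
proof (rule cringI)
  show "abelian_group (int_poly_ring X w)"
    by (rule abelian_groupI)
      (auto intro: carrier_intros simp: algebra_simps intro!: bexI[of _ "- x" for x])
  show "comm_monoid (int_poly_ring X w)"
    by (rule comm_monoidI) (auto intro: carrier_intros simp: algebra_simps)
qed (simp add: algebra_simps)

lemma a_inv_int_poly_ring: "f \<in> carrier (int_poly_ring X w) \<Longrightarrow> \<ominus>\<^bsub>int_poly_ring X w\<^esub> f = - f"
proof -
  interpret cring "int_poly_ring X w" by (rule cring_int_poly_ring)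
  show "f \<in> carrier (int_poly_ring X w) \<Longrightarrow> \<ominus>\<^bsub>int_poly_ring X w\<^esub> f = - f"
    by (rule minus_equality) (simp_all add: carrier_uminus)
qed

lemma additive_subgroup_piece:
  "additive_subgroup (piece (int_poly_ring X w) d) (int_poly_ring X w)"
proof (intro additive_subgroup.intro subgroup.intro)
  fix f assume f: "f \<in> piece (int_poly_ring X w) d"
  then have "\<ominus>\<^bsub>int_poly_ring X w\<^esub> f = - f"
    using piece_subset_carrier by (intro a_inv_int_poly_ring) blast
  with f show "inv\<^bsub>add_monoid (int_poly_ring X w)\<^esub> f \<in> piece (int_poly_ring X w) d"
    by (simp add: a_inv_def piece_uminus)
qed (use piece_subset_carrier[of X w d] in \<open>auto simp: piece_add piece_zero\<close>)

lemma finsum_int_poly_ring: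
  assumes "\<And>x. x \<in> A \<Longrightarrow> f x \<in> carrier (int_poly_ring X w)"
  shows "finsum (int_poly_ring X w) f A = sum f A"
proof -
  interpret cring "int_poly_ring X w" by (rule cring_int_poly_ring)
  from assms show ?thesis
    by (induction A rule: infinite_finite_induct) (auto simp: finsum_insert Pi_def)
qed

definition hom_comp :: "('x \<Rightarrow> nat) \<Rightarrow> int \<Rightarrow> 'x int_poly \<Rightarrow> 'x int_poly" where
  "hom_comp w d = lin_ext (\<lambda>m. if int (weighted_degree w m) = d then single m 1 else 0)"

lemma lookup_of_int_mult: "lookup (of_int c * f) m = c * lookup f m" for f :: "'x int_poly"
proof -
  have "of_int c * f = single 0 c * f"
    by (simp flip: single_of_int)
  also have "lookup \<dots> m = c * lookup f m"
    by (simp flip: mult_map_scale_conv_mult add: map.rep_eq when_def)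
  finally show ?thesis .
qed

lemma lookup_lin_ext:
  "lookup (lin_ext h f) n = (\<Sum>m\<in>keys f. lookup f m * lookup (h m) n)" for h :: "'k \<Rightarrow> 'x int_poly"
  by (simp add: lin_ext_def lookup_sum lookup_of_int_mult)

lemma lookup_lin_ext_filter:
  fixes f :: "'x int_poly"
  shows "lookup (lin_ext (\<lambda>m. if Q m then single m 1 else 0) f) n = (if Q n then lookup f n else 0)"
proof -
  have "lookup f m * lookup (if Q m then single m 1 else 0) n =
      (if m = n then if Q n then lookup f n else 0 else 0)" for m
    by (simp add: lookup_single when_def)
  then show ?thesis
    by (simp add: lookup_lin_ext in_keys_iff)
qed

lemma lookup_hom_comp:
  "lookup (hom_comp w d f) m = (if int (weighted_degree w m) = d then lookup f m else 0)"
  by (simp add: hom_comp_def lookup_lin_ext_filter)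

lemma hom_comp_in_piece:
  assumes "f \<in> carrier (int_poly_ring X w)"
  shows "hom_comp w d f \<in> piece (int_poly_ring X w) d"
proof -
  have "m \<in> keys (hom_comp w d f) \<longleftrightarrow> m \<in> keys f \<and> int (weighted_degree w m) = d" for m
    by (simp add: in_keys_iff[of m] lookup_hom_comp)
  with assms show ?thesis
    by (simp add: piece_int_poly_ring carrier_int_poly_ring)
qed

lemma sum_hom_comp: 
  assumes "finite D" "\<And>m. m \<in> keys f \<Longrightarrow> int (weighted_degree w m) \<in> D"
  shows "(\<Sum>d\<in>D. hom_comp w d f) = f"
  using assms
  by (intro poly_mapping_eqI) (auto simp: lookup_sum lookup_hom_comp in_keys_iff)

lemma hom_comp_sum_pieces:
  assumes "finite D" "\<And>d. f d \<in> piece (int_poly_ring X w) d" "\<And>d. d \<notin> D \<Longrightarrow> f d = 0"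
  shows "hom_comp w d (\<Sum>e\<in>D. f e) = f d"
proof (rule poly_mapping_eqI)
  fix m
  have other: "lookup (f e) m = 0" if "e \<noteq> int (weighted_degree w m)" for e
    using assms(2)[of e] that by (auto simp: piece_int_poly_ring in_keys_iff)
  have "(\<Sum>e\<in>D. lookup (f e) m) = lookup (f (int (weighted_degree w m))) m"
  proof (cases "int (weighted_degree w m) \<in> D")
    case True
    then show ?thesis
      using assms(1) other by (subst sum.remove[of _ "int (weighted_degree w m)"]) auto
  next
    case False
    then have "(\<Sum>e\<in>D. lookup (f e) m) = 0"
      using other by (intro sum.neutral) metis
    with False assms(3) show ?thesis
      by simp
  qed
  then show "lookup (hom_comp w d (\<Sum>e\<in>D. f e)) m = lookup (f d) m"
    using other by (auto simp: lookup_hom_comp lookup_sum)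
qed

lemma is_graded_ring_int_poly_ring: "is_graded_ring (int_poly_ring X w)"
proof -
  let ?P = "int_poly_ring X w"
  have "\<exists>!f. (\<forall>d. f d \<in> piece ?P d) \<and> finite {d. f d \<noteq> \<zero>\<^bsub>?P\<^esub>} \<and>
          x = finsum ?P f {d. f d \<noteq> \<zero>\<^bsub>?P\<^esub>}" if x: "x \<in> carrier ?P" for x
  proof (rule ex1I)
    have fin: "{d. hom_comp w d x \<noteq> 0} \<subseteq> (\<lambda>m. int (weighted_degree w m)) ` keys x"
    proof
      fix d assume "d \<in> {d. hom_comp w d x \<noteq> 0}"
      then obtain m where "lookup (hom_comp w d x) m \<noteq> 0"
        by (metis lookup_zero mem_Collect_eq poly_mapping_eqI)
      then show "d \<in> (\<lambda>m. int (weighted_degree w m)) ` keys x"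
        by (auto simp: lookup_hom_comp in_keys_iff split: if_splits)
    qed
    then have fin': "finite {d. hom_comp w d x \<noteq> 0}"
      by (rule finite_subset) simp
    have "(\<Sum>d | hom_comp w d x \<noteq> 0. hom_comp w d x) =
        (\<Sum>d\<in>(\<lambda>m. int (weighted_degree w m)) ` keys x. hom_comp w d x)"
      using fin by (intro sum.mono_neutral_left) auto
    also have "\<dots> = x"
      by (rule sum_hom_comp) auto
    finally show "(\<forall>d. hom_comp w d x \<in> piece ?P d) \<and> finite {d. hom_comp w d x \<noteq> \<zero>\<^bsub>?P\<^esub>} \<and>
        x = finsum ?P (\<lambda>d. hom_comp w d x) {d. hom_comp w d x \<noteq> \<zero>\<^bsub>?P\<^esub>}"
      using fin' hom_comp_in_piece[OF x] piece_subset_carrier[of X w]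
      by (subst finsum_int_poly_ring) (auto)
  next
    fix f
    assume f: "(\<forall>d. f d \<in> piece ?P d) \<and> finite {d. f d \<noteq> \<zero>\<^bsub>?P\<^esub>} \<and>
          x = finsum ?P f {d. f d \<noteq> \<zero>\<^bsub>?P\<^esub>}"
    then have "f d \<in> carrier ?P" for d
      using piece_subset_carrier by blast
    with f have "x = sum f {d. f d \<noteq> 0}"
      by (simp add: finsum_int_poly_ring)
    moreover have "hom_comp w d (sum f {d. f d \<noteq> 0}) = f d" for d
      using f by (intro hom_comp_sum_pieces[of _ _ X]) auto
    ultimately show "f = (\<lambda>d. hom_comp w d x)"
      by simp
  qed
  then show ?thesis
    unfolding is_graded_ring_def
    by (auto simp: cring_int_poly_ring additive_subgroup_piece piece_one piece_mult)
qed

lemma poly_subst_in_piece: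
  assumes "f \<in> piece (int_poly_ring X w) d"
    and "\<And>x. x \<in> X \<Longrightarrow> g x \<in> piece (int_poly_ring Y v) (int (w x))"
  shows "poly_subst g f \<in> piece (int_poly_ring Y v) d"
  unfolding poly_subst_def
proof (intro piece_sum piece_scale)
  fix m assume m: "m \<in> keys f"
  have "(\<Prod>x\<in>keys m. g x ^ lookup m x) \<in>
      piece (int_poly_ring Y v) (\<Sum>x\<in>keys m. int (lookup m x) * int (w x))"
    using m assms(1) by (intro piece_prod piece_power assms(2)) (auto simp: piece_int_poly_ring[of f])
  also have "(\<Sum>x\<in>keys m. int (lookup m x) * int (w x)) = d"
    using m assms(1) by (auto simp: piece_int_poly_ring weighted_degree_def mult.commute)
  finally show "(\<Prod>x\<in>keys m. g x ^ lookup m x) \<in> piece (int_poly_ring Y v) d" .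
qed

lemma poly_subst_in_carrier:
  assumes "f \<in> carrier (int_poly_ring X w)"
    and "\<And>x. x \<in> X \<Longrightarrow> g x \<in> carrier (int_poly_ring Y v)"
  shows "poly_subst g f \<in> carrier (int_poly_ring Y v)"
  unfolding poly_subst_def using assms(1)
  by (intro carrier_intros assms(2)) (auto simp: carrier_int_poly_ring[of f])

lemma poly_subst_graded_hom:
  assumes "\<And>x. x \<in> X \<Longrightarrow> g x \<in> piece (int_poly_ring Y v) (int (w x))"
  shows "poly_subst g \<in> graded_hom (int_poly_ring X w) (int_poly_ring Y v)"
proof -
  have "poly_subst g f \<in> carrier (int_poly_ring Y v)" if "f \<in> carrier (int_poly_ring X w)" for f
    using that assms piece_subset_carrier by (intro poly_subst_in_carrier) blast+
  then show ?thesis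
    using assms unfolding graded_hom_def ring_hom_def
    by (auto simp: poly_subst_add poly_subst_mult intro: poly_subst_in_piece)
qed

section \<open>Simplicial posets\<close>

lemma card_eq_if_bij_Pow:
  assumes "bij_betw f A (Pow B)" "bij_betw g A (Pow C)" "finite B" "finite C"
  shows "card B = card C"
proof -
  have "card (Pow B) = card (Pow C)"
    using assms(1,2) by (metis bij_betw_same_card)
  then show ?thesis
    using assms(3,4) by (simp add: card_Pow)
qed

context simplicial_poset
begin

(* As introduction rules these apply to every inequality and every equality between faces. *)
declare le_antisym [rule del] weak_le_antisym [rule del] le_cong_l [rule del] le_cong_r [rule del]
  weak_refl [rule del]

lemma segment_iff: "x \<in> \<lbrace>\<bottom>..\<sigma>\<rbrace> \<longleftrightarrow> x \<in> carrier S \<and> x \<sqsubseteq> \<sigma>"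
  by (auto simp: at_least_at_most_def)

lemma rank_eq:
  assumes "simplex_segment S \<sigma> k"
  shows "rank S \<sigma> = k"
  unfolding rank_def
proof (rule the_equality, rule assms)
  fix j assume "simplex_segment S \<sigma> j"
  with assms show "j = k"
    unfolding simplex_segment_def using card_eq_if_bij_Pow[of _ _ "{..<j}" _ "{..<k}"] by auto
qed

lemma vertices_finite: "finite (vertices S \<sigma>)"
  by (rule finite_subset[OF _ finite_carrier]) (auto simp: vertices_def)

lemma vertices_carrier: "vertices S \<sigma> \<subseteq> carrier S"
  by (auto simp: vertices_def)

text \<open>An isomorphism of the segment below \<open>\<sigma>\<close> with a power set restricts to the segment below a face
  \<open>\<tau>\<close> of \<open>\<sigma>\<close>, with image the power set of \<open>\<phi> \<tau>\<close>. So it computes the ranks of all faces of \<open>\<sigma>\<close>.\<close>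

lemma rank_face:
  fixes k :: nat
  assumes \<phi>: "bij_betw \<phi> \<lbrace>\<bottom>..\<sigma>\<rbrace> (Pow {..<k})"
    and mono: "\<And>x y. x \<in> \<lbrace>\<bottom>..\<sigma>\<rbrace> \<Longrightarrow> y \<in> \<lbrace>\<bottom>..\<sigma>\<rbrace> \<Longrightarrow> x \<sqsubseteq> y \<longleftrightarrow> \<phi> x \<subseteq> \<phi> y"
    and \<sigma>: "\<sigma> \<in> carrier S" and \<tau>: "\<tau> \<in> carrier S" "\<tau> \<sqsubseteq> \<sigma>"
  shows "rank S \<tau> = card (\<phi> \<tau>)"
proof -
  have \<tau>_seg: "\<tau> \<in> \<lbrace>\<bottom>..\<sigma>\<rbrace>"
    using \<tau> by (simp add: segment_iff)
  have bounded: "\<phi> \<tau> \<subseteq> {..<k}"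
    using bij_betw_imp_surj_on[OF \<phi>] \<tau>_seg by blast
  have sub: "\<lbrace>\<bottom>..\<tau>\<rbrace> \<subseteq> \<lbrace>\<bottom>..\<sigma>\<rbrace>"
    using le_trans[OF _ \<tau>(2) _ \<tau>(1) \<sigma>] by (auto simp: segment_iff)
  have image: "\<phi> ` \<lbrace>\<bottom>..\<tau>\<rbrace> = Pow (\<phi> \<tau>)"
  proof (intro equalityI subsetI)
    fix B assume "B \<in> \<phi> ` \<lbrace>\<bottom>..\<tau>\<rbrace>"
    then obtain x where "x \<in> \<lbrace>\<bottom>..\<tau>\<rbrace>" "B = \<phi> x"
      by blast
    with subsetD[OF sub] \<tau>_seg mono[of x \<tau>] show "B \<in> Pow (\<phi> \<tau>)"
      by (auto simp: segment_iff)
  next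
    fix B assume B: "B \<in> Pow (\<phi> \<tau>)"
    with bounded have "B \<in> \<phi> ` \<lbrace>\<bottom>..\<sigma>\<rbrace>"
      unfolding bij_betw_imp_surj_on[OF \<phi>] by blast
    then obtain x where x: "x \<in> \<lbrace>\<bottom>..\<sigma>\<rbrace>" "B = \<phi> x"
      by blast
    with B mono[of x \<tau>] \<tau>_seg have "x \<in> \<lbrace>\<bottom>..\<tau>\<rbrace>"
      by (auto simp: segment_iff)
    with x show "B \<in> \<phi> ` \<lbrace>\<bottom>..\<tau>\<rbrace>"
      by blast
  qed
  have bij: "bij_betw \<phi> \<lbrace>\<bottom>..\<tau>\<rbrace> (Pow (\<phi> \<tau>))"
    using inj_on_subset[OF bij_betw_imp_inj_on[OF \<phi>] sub] image by (rule bij_betw_imageI)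
  have "finite (\<phi> \<tau>)"
    using finite_subset[OF bounded] by simp
  moreover obtain j where j: "simplex_segment S \<tau> j"
    using boolean_segments \<tau> by blast
  ultimately show ?thesis
    using rank_eq[OF j] bij j card_eq_if_bij_Pow[of _ "\<lbrace>\<bottom>..\<tau>\<rbrace>" "{..<j}" \<phi> "\<phi> \<tau>"]
    by (auto simp: simplex_segment_def)
qed

lemma vertices_mono:
  assumes "\<sigma> \<in> carrier S" "\<tau> \<in> carrier S" "\<sigma> \<sqsubseteq> \<tau>"
  shows "vertices S \<sigma> \<subseteq> vertices S \<tau>"
  using le_trans[OF _ assms(3) _ assms(1,2)] by (auto simp: vertices_def)

text \<open>The unspecified isomorphism of a segment with a power set can be replaced by the canonical one,
  which sends a face to its vertices: under any isomorphism the faces of rank one correspond to the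
  singletons. All further facts on segments are read off from this description.\<close>

lemma
  assumes \<rho>: "\<rho> \<in> carrier S"
  shows le_iff_vertices: "\<And>\<sigma> \<tau>. \<lbrakk>\<sigma> \<in> carrier S; \<sigma> \<sqsubseteq> \<rho>; \<tau> \<in> carrier S; \<tau> \<sqsubseteq> \<rho>\<rbrakk> \<Longrightarrow>
      \<sigma> \<sqsubseteq> \<tau> \<longleftrightarrow> vertices S \<sigma> \<subseteq> vertices S \<tau>"
    and face_with_vertices: "\<And>A. A \<subseteq> vertices S \<rho> \<Longrightarrow>
      \<exists>\<sigma>\<in>carrier S. \<sigma> \<sqsubseteq> \<rho> \<and> vertices S \<sigma> = A"
    and card_vertices: "card (vertices S \<rho>) = rank S \<rho>"
proof -
  obtain k and \<phi> :: "'a \<Rightarrow> nat set" where \<phi>: "bij_betw \<phi> \<lbrace>\<bottom>..\<rho>\<rbrace> (Pow {..<k})"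
    and mono: "\<And>x y. x \<in> \<lbrace>\<bottom>..\<rho>\<rbrace> \<Longrightarrow> y \<in> \<lbrace>\<bottom>..\<rho>\<rbrace> \<Longrightarrow> x \<sqsubseteq> y \<longleftrightarrow> \<phi> x \<subseteq> \<phi> y"
    using boolean_segments[OF \<rho>] unfolding simplex_segment_def by blast
  define v where "v j = inv_into \<lbrace>\<bottom>..\<rho>\<rbrace> \<phi> {j}" for j
  have v: "v j \<in> carrier S" "v j \<sqsubseteq> \<rho>" "\<phi> (v j) = {j}" if "j < k" for j
  proof -
    have "{j} \<in> \<phi> ` \<lbrace>\<bottom>..\<rho>\<rbrace>"
      unfolding bij_betw_imp_surj_on[OF \<phi>] using that by simp
    then show "v j \<in> carrier S" "v j \<sqsubseteq> \<rho>" "\<phi> (v j) = {j}"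
      using inv_into_into[of "{j}" \<phi> "\<lbrace>\<bottom>..\<rho>\<rbrace>"] f_inv_into_f[of "{j}" \<phi> "\<lbrace>\<bottom>..\<rho>\<rbrace>"]
      by (simp_all add: v_def segment_iff)
  qed
  have \<phi>_sub: "\<phi> x \<subseteq> {..<k}" if "x \<in> carrier S" "x \<sqsubseteq> \<rho>" for x
    using bij_betw_imp_surj_on[OF \<phi>] that segment_iff by blast
  have vertices: "vertices S x = v ` \<phi> x" if x: "x \<in> carrier S" "x \<sqsubseteq> \<rho>" for x
  proof (intro equalityI subsetI)
    fix i assume "i \<in> vertices S x"
    then have i: "i \<in> carrier S" "rank S i = 1" "i \<sqsubseteq> x"
      by (auto simp: vertices_def)
    with x \<rho> have "i \<sqsubseteq> \<rho>"
      using le_trans[of i x \<rho>] by simp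
    with i have "card (\<phi> i) = 1"
      using rank_face[OF \<phi> mono \<rho>] by auto
    then obtain j where j: "\<phi> i = {j}"
      by (auto simp: card_1_singleton_iff)
    with \<phi>_sub[OF i(1) \<open>i \<sqsubseteq> \<rho>\<close>] have "j < k"
      by auto
    then have "i = v j"
      using j v[of j] i \<open>i \<sqsubseteq> \<rho>\<close> inj_onD[OF bij_betw_imp_inj_on[OF \<phi>], of i "v j"]
      by (simp add: segment_iff)
    moreover have "j \<in> \<phi> x"
      using mono[of i x] i x \<open>i \<sqsubseteq> \<rho>\<close> j by (auto simp: segment_iff)
    ultimately show "i \<in> v ` \<phi> x"
      by blast
  next
    fix i assume "i \<in> v ` \<phi> x"
    then obtain j where j: "j \<in> \<phi> x" "i = v j"
      by blast
    with \<phi>_sub[OF x] have "j < k"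
      by auto
    note v = v[OF this]
    have "rank S (v j) = 1"
      using rank_face[OF \<phi> mono \<rho> v(1,2)] v(3) by simp
    moreover have "v j \<sqsubseteq> x"
      using mono[of "v j" x] x v j by (auto simp: segment_iff)
    ultimately show "i \<in> vertices S x"
      using j v by (simp add: vertices_def)
  qed
  have inj: "inj_on v {..<k}"
    using v(3) by (metis inj_onI lessThan_iff the_elem_eq)
  have image_v: "v ` A \<subseteq> v ` B \<longleftrightarrow> A \<subseteq> B" if "A \<subseteq> {..<k}" "B \<subseteq> {..<k}" for A B
    using that inj_on_image_mem_iff[OF inj _ that(2)] by blast
  show "\<sigma> \<sqsubseteq> \<tau> \<longleftrightarrow> vertices S \<sigma> \<subseteq> vertices S \<tau>"
    if "\<sigma> \<in> carrier S" "\<sigma> \<sqsubseteq> \<rho>" "\<tau> \<in> carrier S" "\<tau> \<sqsubseteq> \<rho>" for \<sigma> \<tau>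
    using that mono[of \<sigma> \<tau>] vertices[of \<sigma>] vertices[of \<tau>] \<phi>_sub[of \<sigma>] \<phi>_sub[of \<tau>]
    by (simp add: segment_iff image_v)
  show "\<exists>\<sigma>\<in>carrier S. \<sigma> \<sqsubseteq> \<rho> \<and> vertices S \<sigma> = A" if A: "A \<subseteq> vertices S \<rho>" for A
  proof -
    obtain B where B: "B \<subseteq> \<phi> \<rho>" "A = v ` B"
      using A vertices[OF \<rho>] \<rho> by (auto simp: subset_image_iff)
    then have "B \<in> \<phi> ` \<lbrace>\<bottom>..\<rho>\<rbrace>"
      unfolding bij_betw_imp_surj_on[OF \<phi>] using \<phi>_sub[of \<rho>] \<rho> by auto
    then obtain x where "x \<in> carrier S" "x \<sqsubseteq> \<rho>" "B = \<phi> x"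
      by (auto simp: segment_iff)
    with B vertices show ?thesis
      by auto
  qed
  show "card (vertices S \<rho>) = rank S \<rho>"
    using vertices[of \<rho>] rank_face[OF \<phi> mono \<rho> \<rho>] card_image[OF inj_on_subset[OF inj]]
      \<phi>_sub[of \<rho>] \<rho> by simp
qed

lemma vertices_eqD:
  assumes "\<rho> \<in> carrier S" "\<sigma> \<in> carrier S" "\<sigma> \<sqsubseteq> \<rho>" "\<tau> \<in> carrier S" "\<tau> \<sqsubseteq> \<rho>"
    and "vertices S \<sigma> = vertices S \<tau>"
  shows "\<sigma> = \<tau>"
  using assms le_iff_vertices[of \<rho> \<sigma> \<tau>] le_iff_vertices[of \<rho> \<tau> \<sigma>] le_antisym by blast

lemma vertices_bottom [simp]: "vertices S \<bottom> = {}"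
proof -
  obtain \<sigma> where "\<sigma> \<in> carrier S" "\<sigma> \<sqsubseteq> \<bottom>" "vertices S \<sigma> = {}"
    using face_with_vertices[of \<bottom> "{}"] bottom_closed by auto
  moreover from this have "\<sigma> = \<bottom>"
    using le_antisym bottom_lower bottom_closed by blast
  ultimately show ?thesis
    by simp
qed

lemma vertex:
  assumes "i \<in> vertices S \<sigma>"
  shows vertex_carrier: "i \<in> carrier S" and vertex_le: "i \<sqsubseteq> \<sigma>" and rank_vertex: "rank S i = 1"
    and vertices_vertex: "vertices S i = {i}"
proof -
  show i: "i \<in> carrier S" "i \<sqsubseteq> \<sigma>" "rank S i = 1"
    using assms by (auto simp: vertices_def)
  then have "i \<in> vertices S i"
    by (simp add: vertices_def)
  moreover have "card (vertices S i) = 1"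
    using card_vertices i by simp
  ultimately show "vertices S i = {i}"
    by (auto simp: card_1_singleton_iff)
qed

lemma joins_iff:
  assumes "\<sigma> \<in> carrier S" "\<tau> \<in> carrier S"
  shows "\<eta> \<in> joins S \<sigma> \<tau> \<longleftrightarrow> \<eta> \<in> carrier S \<and> \<sigma> \<sqsubseteq> \<eta> \<and> \<tau> \<sqsubseteq> \<eta> \<and>
    (\<forall>\<zeta>. \<zeta> \<in> carrier S \<and> \<sigma> \<sqsubseteq> \<zeta> \<and> \<tau> \<sqsubseteq> \<zeta> \<and> \<zeta> \<sqsubseteq> \<eta> \<longrightarrow> \<zeta> = \<eta>)"
  using assms by (auto simp: joins_def Upper_def)

lemma meets_iff:
  assumes "\<sigma> \<in> carrier S" "\<tau> \<in> carrier S"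
  shows "\<eta> \<in> meets S \<sigma> \<tau> \<longleftrightarrow> \<eta> \<in> carrier S \<and> \<eta> \<sqsubseteq> \<sigma> \<and> \<eta> \<sqsubseteq> \<tau> \<and>
    (\<forall>\<zeta>. \<zeta> \<in> carrier S \<and> \<zeta> \<sqsubseteq> \<sigma> \<and> \<zeta> \<sqsubseteq> \<tau> \<and> \<eta> \<sqsubseteq> \<zeta> \<longrightarrow> \<zeta> = \<eta>)"
  using assms by (auto simp: meets_def Lower_def)

lemma joins_subset: 
  assumes "\<sigma> \<in> carrier S" "\<tau> \<in> carrier S" "\<eta> \<in> joins S \<sigma> \<tau>"
  shows "\<eta> \<in> carrier S" "\<sigma> \<sqsubseteq> \<eta>" "\<tau> \<sqsubseteq> \<eta>"
  using assms by (simp_all add: joins_iff)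

lemma finite_joins: "finite (joins S \<sigma> \<tau>)"
  by (rule finite_subset[OF _ finite_carrier]) (auto simp: joins_def Upper_def)

text \<open>Below a common upper bound \<open>\<rho>\<close>, joins and meets are computed in the boolean lattice of the
  faces of \<open>\<rho>\<close>. Distinct elements of \<open>joins S \<sigma> \<tau>\<close> therefore have no common upper bound.\<close>

lemma ex1_join_below:
  assumes \<sigma>: "\<sigma> \<in> carrier S" "\<sigma> \<sqsubseteq> \<rho>" and \<tau>: "\<tau> \<in> carrier S" "\<tau> \<sqsubseteq> \<rho>" and \<rho>: "\<rho> \<in> carrier S"
  shows "\<exists>\<eta>\<in>joins S \<sigma> \<tau>. {\<zeta> \<in> joins S \<sigma> \<tau>. \<zeta> \<sqsubseteq> \<rho>} = {\<eta>} \<and>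
      vertices S \<eta> = vertices S \<sigma> \<union> vertices S \<tau>"
proof -
  have "vertices S \<sigma> \<union> vertices S \<tau> \<subseteq> vertices S \<rho>"
    using assms vertices_mono by simp
  then obtain \<eta> where \<eta>: "\<eta> \<in> carrier S" "\<eta> \<sqsubseteq> \<rho>" "vertices S \<eta> = vertices S \<sigma> \<union> vertices S \<tau>"
    using face_with_vertices[OF \<rho>] by blast
  have least: "\<eta> \<sqsubseteq> \<zeta>" if "\<zeta> \<in> carrier S" "\<sigma> \<sqsubseteq> \<zeta>" "\<tau> \<sqsubseteq> \<zeta>" "\<zeta> \<sqsubseteq> \<rho>" for \<zeta>
    using that \<eta> vertices_mono[OF \<sigma>(1) that(1,2)] vertices_mono[OF \<tau>(1) that(1,3)]
    by (simp add: le_iff_vertices[OF \<rho> \<eta>(1,2) that(1,4)])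
  have upper: "\<sigma> \<sqsubseteq> \<eta>" "\<tau> \<sqsubseteq> \<eta>"
    using \<eta>(3) le_iff_vertices[OF \<rho> \<sigma> \<eta>(1,2)] le_iff_vertices[OF \<rho> \<tau> \<eta>(1,2)] by simp_all
  have join: "\<eta> \<in> joins S \<sigma> \<tau>"
  proof -
    have "\<zeta> = \<eta>" if \<zeta>: "\<zeta> \<in> carrier S" "\<sigma> \<sqsubseteq> \<zeta>" "\<tau> \<sqsubseteq> \<zeta>" "\<zeta> \<sqsubseteq> \<eta>" for \<zeta>
      using le_antisym[OF \<zeta>(4) least] le_trans[OF \<zeta>(4) \<eta>(2) \<zeta>(1) \<eta>(1) \<rho>] \<zeta> \<eta>(1) by simp
    with \<sigma>(1) \<tau>(1) \<eta>(1) upper show ?thesis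
      by (simp add: joins_iff)
  qed
  moreover have "\<zeta> = \<eta>" if "\<zeta> \<in> joins S \<sigma> \<tau>" "\<zeta> \<sqsubseteq> \<rho>" for \<zeta>
    using that \<eta>(1) upper least[of \<zeta>] joins_iff[OF \<sigma>(1) \<tau>(1)] by metis
  ultimately show ?thesis
    using \<eta>(2,3) by blast
qed

lemma vertices_join:
  assumes "\<sigma> \<in> carrier S" "\<tau> \<in> carrier S" "\<eta> \<in> joins S \<sigma> \<tau>"
  shows "vertices S \<eta> = vertices S \<sigma> \<union> vertices S \<tau>"
proof -
  note \<eta> = joins_subset[OF assms]
  obtain \<eta>' where "{\<zeta> \<in> joins S \<sigma> \<tau>. \<zeta> \<sqsubseteq> \<eta>} = {\<eta>'}"
    and \<eta>': "vertices S \<eta>' = vertices S \<sigma> \<union> vertices S \<tau>"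
    using ex1_join_below[OF assms(1) \<eta>(2) assms(2) \<eta>(3) \<eta>(1)] by blast
  moreover have "\<eta> \<in> {\<zeta> \<in> joins S \<sigma> \<tau>. \<zeta> \<sqsubseteq> \<eta>}"
    using assms(3) \<eta>(1) by simp
  ultimately show ?thesis
    by simp
qed

lemma meets_below:
  assumes \<sigma>: "\<sigma> \<in> carrier S" "\<sigma> \<sqsubseteq> \<rho>" and \<tau>: "\<tau> \<in> carrier S" "\<tau> \<sqsubseteq> \<rho>" and \<rho>: "\<rho> \<in> carrier S"
  shows "\<exists>\<mu>\<in>carrier S. meets S \<sigma> \<tau> = {\<mu>} \<and> \<mu> \<sqsubseteq> \<sigma> \<and> \<mu> \<sqsubseteq> \<tau> \<and>
      vertices S \<mu> = vertices S \<sigma> \<inter> vertices S \<tau>"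
proof -
  have "vertices S \<sigma> \<inter> vertices S \<tau> \<subseteq> vertices S \<rho>"
    using assms vertices_mono by blast
  then obtain \<mu> where \<mu>: "\<mu> \<in> carrier S" "\<mu> \<sqsubseteq> \<rho>" "vertices S \<mu> = vertices S \<sigma> \<inter> vertices S \<tau>"
    using face_with_vertices[OF \<rho>] by blast
  have greatest: "\<zeta> \<sqsubseteq> \<mu>" if \<zeta>: "\<zeta> \<in> carrier S" "\<zeta> \<sqsubseteq> \<sigma>" "\<zeta> \<sqsubseteq> \<tau>" for \<zeta>
  proof -
    have "\<zeta> \<sqsubseteq> \<rho>"
      using le_trans[OF \<zeta>(2) \<sigma>(2) \<zeta>(1) \<sigma>(1) \<rho>] .
    from le_iff_vertices[OF \<rho> \<zeta>(1) this \<mu>(1,2)] \<mu>(3)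
      vertices_mono[OF \<zeta>(1) \<sigma>(1) \<zeta>(2)] vertices_mono[OF \<zeta>(1) \<tau>(1) \<zeta>(3)]
    show ?thesis
      by simp
  qed
  have lower: "\<mu> \<sqsubseteq> \<sigma>" "\<mu> \<sqsubseteq> \<tau>"
    using \<mu>(3) le_iff_vertices[OF \<rho> \<mu>(1,2) \<sigma>] le_iff_vertices[OF \<rho> \<mu>(1,2) \<tau>] by simp_all
  have "meets S \<sigma> \<tau> = {\<mu>}"
  proof (intro equalityI subsetI)
    fix \<zeta> assume "\<zeta> \<in> meets S \<sigma> \<tau>"
    then show "\<zeta> \<in> {\<mu>}"
      using \<mu>(1) lower greatest[of \<zeta>] meets_iff[OF \<sigma>(1) \<tau>(1)] by (metis singletonI)
  next
    fix \<zeta> assume "\<zeta> \<in> {\<mu>}"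
    then show "\<zeta> \<in> meets S \<sigma> \<tau>"
      using \<sigma>(1) \<tau>(1) \<mu>(1) lower le_antisym[OF greatest]
      by (simp add: meets_iff)
  qed
  with \<mu> lower show ?thesis
    by blast
qed

lemma joins_eq_empty:
  assumes "\<sigma> \<in> carrier S" "\<tau> \<in> carrier S" "\<And>\<rho>. \<rho> \<in> carrier S \<Longrightarrow> \<sigma> \<sqsubseteq> \<rho> \<Longrightarrow> \<not> \<tau> \<sqsubseteq> \<rho>"
  shows "joins S \<sigma> \<tau> = {}"
  using assms joins_subset by blast

section \<open>Straightening in the face ring\<close>

lemma face_poly_ring_ops [simp]:
  "x \<otimes>\<^bsub>face_poly_ring S\<^esub> y = x * y" "x \<oplus>\<^bsub>face_poly_ring S\<^esub> y = x + y"
  "\<one>\<^bsub>face_poly_ring S\<^esub> = 1" "\<zero>\<^bsub>face_poly_ring S\<^esub> = 0"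
  by (simp_all add: face_poly_ring_def)

lemma cring_face_poly_ring: "cring (face_poly_ring S)"
  by (simp add: face_poly_ring_def cring_int_poly_ring)

lemmas face_poly_intros =
  carrier_intros[where X = "carrier S" and w = "\<lambda>\<sigma>. 2 * rank S \<sigma>", folded face_poly_ring_def]

lemma var_in_face_poly_ring: "\<sigma> \<in> carrier S \<Longrightarrow> var \<sigma> \<in> carrier (face_poly_ring S)"
  by (simp add: face_poly_ring_def carrier_var)

lemma of_int_in_face_poly_ring: "of_int c \<in> carrier (face_poly_ring S)"
  by (simp add: face_poly_ring_def carrier_of_int)

lemma var_vertex_in_face_poly_ring: "i \<in> vertices S \<sigma> \<Longrightarrow> var i \<in> carrier (face_poly_ring S)"
  using var_in_face_poly_ring vertex_carrier by blast

lemma face_relations_carrier: "face_relations S \<subseteq> carrier (face_poly_ring S)"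
proof -
  have "var \<sigma> * var \<tau> - var (the_elem (meets S \<sigma> \<tau>)) * (\<Sum>\<eta> \<in> joins S \<sigma> \<tau>. var \<eta>) \<in>
      carrier (face_poly_ring S)" if \<sigma>: "\<sigma> \<in> carrier S" and \<tau>: "\<tau> \<in> carrier S" for \<sigma> \<tau>
  proof (cases "joins S \<sigma> \<tau> = {}")
    case True
    with \<sigma> \<tau> show ?thesis
      by (simp add: face_poly_intros)
  next
    case False
    then obtain \<eta> where "\<eta> \<in> joins S \<sigma> \<tau>"
      by blast
    from joins_subset[OF \<sigma> \<tau> this] have "the_elem (meets S \<sigma> \<tau>) \<in> carrier S"
      using meets_below[OF \<sigma> _ \<tau>, of \<eta>] by force
    with \<sigma> \<tau> show ?thesis
      using joins_subset(1)[OF \<sigma> \<tau>] by (intro face_poly_intros)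
  qed
  moreover have "var \<bottom> - 1 \<in> carrier (face_poly_ring S)"
    by (intro face_poly_intros bottom_closed)
  ultimately show ?thesis
    by (auto simp: face_relations_def)
qed

lemma ideal_face_ideal: "ideal (face_ideal S) (face_poly_ring S)"
  unfolding face_ideal_def
  by (intro ring.genideal_ideal cring.axioms(1) cring_face_poly_ring face_relations_carrier)

lemma face_ideal_add: "f \<in> face_ideal S \<Longrightarrow> g \<in> face_ideal S \<Longrightarrow> f + g \<in> face_ideal S"
  using additive_subgroup.a_closed[OF ideal.axioms(1)[OF ideal_face_ideal]] by simp

lemma face_ideal_zero: "0 \<in> face_ideal S"
  using additive_subgroup.zero_closed[OF ideal.axioms(1)[OF ideal_face_ideal]] by simp

lemma face_ideal_mult:
  "f \<in> carrier (face_poly_ring S) \<Longrightarrow> g \<in> face_ideal S \<Longrightarrow> f * g \<in> face_ideal S"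
  using ideal.I_l_closed[OF ideal_face_ideal] by simp

lemma face_ideal_uminus: "f \<in> face_ideal S \<Longrightarrow> - f \<in> face_ideal S"
  using face_ideal_mult[of "- 1" f] by (simp add: face_poly_intros)

lemma face_ideal_sum: "(\<And>x. x \<in> A \<Longrightarrow> f x \<in> face_ideal S) \<Longrightarrow> sum f A \<in> face_ideal S"
  by (induction A rule: infinite_finite_induct) (auto intro: face_ideal_zero face_ideal_add)

definition face_cong :: "'a int_poly \<Rightarrow> 'a int_poly \<Rightarrow> bool" (infix "\<doteq>" 50) where
  "f \<doteq> g \<longleftrightarrow> f - g \<in> face_ideal S"

lemma face_cong_refl [simp]: "f \<doteq> f"
  by (simp add: face_cong_def face_ideal_zero)

lemma face_cong_sym: "f \<doteq> g \<Longrightarrow> g \<doteq> f"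
  using face_ideal_uminus[of "f - g"] by (simp add: face_cong_def)

lemma face_cong_trans [trans]: "f \<doteq> g \<Longrightarrow> g \<doteq> h \<Longrightarrow> f \<doteq> h"
  using face_ideal_add[of "f - g" "g - h"] by (simp add: face_cong_def)

lemma face_cong_add: "f \<doteq> g \<Longrightarrow> f' \<doteq> g' \<Longrightarrow> f + f' \<doteq> g + g'"
  using face_ideal_add[of "f - g" "f' - g'"] by (simp add: face_cong_def algebra_simps)

lemma face_cong_sum: "(\<And>x. x \<in> A \<Longrightarrow> f x \<doteq> g x) \<Longrightarrow> sum f A \<doteq> sum g A"
  using face_ideal_sum[of A "\<lambda>x. f x - g x"] by (simp add: face_cong_def sum_subtractf)

lemma face_cong_mult: "h \<in> carrier (face_poly_ring S) \<Longrightarrow> f \<doteq> g \<Longrightarrow> h * f \<doteq> h * g"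
  using face_ideal_mult[of h "f - g"] by (simp add: face_cong_def algebra_simps)

lemma face_relation: "f - g \<in> face_relations S \<Longrightarrow> f \<doteq> g"
  unfolding face_cong_def face_ideal_def
  using ring.genideal_self[OF cring.axioms(1)[OF cring_face_poly_ring] face_relations_carrier] by blast

lemma var_bottom_cong: "var \<bottom> \<doteq> 1"
  by (rule face_relation) (simp add: face_relations_def)

lemma var_mult_cong:
  assumes "\<sigma> \<in> carrier S" "\<tau> \<in> carrier S"
  shows "var \<sigma> * var \<tau> \<doteq> var (the_elem (meets S \<sigma> \<tau>)) * (\<Sum>\<eta> \<in> joins S \<sigma> \<tau>. var \<eta>)"
  using assms by (intro face_relation) (auto simp: face_relations_def)

lemma var_mult_cong_zero:
  assumes "\<sigma> \<in> carrier S" "\<tau> \<in> carrier S" "\<And>\<rho>. \<rho> \<in> carrier S \<Longrightarrow> \<sigma> \<sqsubseteq> \<rho> \<Longrightarrow> \<not> \<tau> \<sqsubseteq> \<rho>"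
  shows "var \<sigma> * var \<tau> \<doteq> 0"
  using var_mult_cong[OF assms(1,2)] joins_eq_empty[OF assms] by simp

text \<open>The relation for \<open>v\<^sub>\<zeta> v\<^sub>i\<close> produces a sum over all joins of \<open>\<zeta>\<close> and \<open>i\<close>. The factor \<open>v\<^sub>\<eta>\<close>
  selects the one below \<open>\<eta>\<close>: another join has no common upper bound with \<open>\<eta>\<close>, since it would
  be a second join inside the segment of that bound, so its product with \<open>v\<^sub>\<eta>\<close> vanishes.\<close>

lemma var_mult_vertex_cong:
  assumes \<eta>: "\<eta> \<in> carrier S" and \<zeta>: "\<zeta> \<in> carrier S" "\<zeta> \<sqsubseteq> \<eta>"
    and i: "i \<in> vertices S \<eta>" "i \<notin> vertices S \<zeta>"
    and \<zeta>': "\<zeta>' \<in> carrier S" "\<zeta>' \<sqsubseteq> \<eta>" "vertices S \<zeta>' = insert i (vertices S \<zeta>)"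
  shows "var \<eta> * (var \<zeta> * var i) \<doteq> var \<eta> * var \<zeta>'"
proof -
  note i' = vertex_carrier[OF i(1)] vertex_le[OF i(1)]
  obtain \<mu> where \<mu>: "\<mu> \<in> carrier S" "meets S \<zeta> i = {\<mu>}" "\<mu> \<sqsubseteq> \<zeta>" "vertices S \<mu> = {}"
    using meets_below[OF \<zeta> i' \<eta>] vertices_vertex[OF i(1)] i(2) by auto
  have "\<mu> = \<bottom>"
    using vertices_eqD[OF \<zeta>(1) \<mu>(1,3) bottom_closed] \<mu>(4) \<zeta>(1) by simp
  obtain \<eta>\<^sub>0 where \<eta>\<^sub>0: "\<eta>\<^sub>0 \<in> joins S \<zeta> i" "\<eta>\<^sub>0 \<sqsubseteq> \<eta>" "vertices S \<eta>\<^sub>0 = vertices S \<zeta> \<union> {i}"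
    using ex1_join_below[OF \<zeta> i' \<eta>] vertices_vertex[OF i(1)] by auto
  then have "\<eta>\<^sub>0 = \<zeta>'"
    using vertices_eqD[OF \<eta> joins_subset(1)[OF \<zeta>(1) i'(1) \<eta>\<^sub>0(1)] \<eta>\<^sub>0(2) \<zeta>'(1,2)] \<zeta>'(3) by simp
  with \<eta>\<^sub>0 have join: "\<zeta>' \<in> joins S \<zeta> i"
    by simp
  have other: "var \<eta> * var \<theta> \<doteq> 0" if \<theta>: "\<theta> \<in> joins S \<zeta> i" "\<theta> \<noteq> \<zeta>'" for \<theta>
  proof (rule var_mult_cong_zero[OF \<eta>])
    show \<theta>_carrier: "\<theta> \<in> carrier S"
      using joins_subset(1)[OF \<zeta>(1) i'(1) \<theta>(1)] .
    fix \<rho> assume \<rho>: "\<rho> \<in> carrier S" "\<eta> \<sqsubseteq> \<rho>"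
    show "\<not> \<theta> \<sqsubseteq> \<rho>"
    proof
      assume \<theta>_le: "\<theta> \<sqsubseteq> \<rho>"
      have le: "x \<sqsubseteq> \<rho>" if "x \<in> carrier S" "x \<sqsubseteq> \<eta>" for x
        using le_trans[OF that(2) \<rho>(2) that(1) \<eta> \<rho>(1)] .
      obtain \<xi> where "{x \<in> joins S \<zeta> i. x \<sqsubseteq> \<rho>} = {\<xi>}"
        using ex1_join_below[OF \<zeta>(1) le[OF \<zeta>] i'(1) le[OF i'] \<rho>(1)] by blast
      moreover have "\<theta> \<in> {x \<in> joins S \<zeta> i. x \<sqsubseteq> \<rho>}" "\<zeta>' \<in> {x \<in> joins S \<zeta> i. x \<sqsubseteq> \<rho>}"
        using \<theta>(1) \<theta>_le join le[OF \<zeta>'(1,2)] by simp_all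
      ultimately show False
        using \<theta>(2) by simp
    qed
  qed
  have joins_carrier: "(\<Sum>\<theta>\<in>joins S \<zeta> i. var \<theta>) \<in> carrier (face_poly_ring S)"
    using joins_subset(1)[OF \<zeta>(1) i'(1)] by (intro face_poly_intros)
  have "var \<zeta> * var i \<doteq> var \<bottom> * (\<Sum>\<theta>\<in>joins S \<zeta> i. var \<theta>)"
    using var_mult_cong[OF \<zeta>(1) i'(1)] \<mu>(2) \<open>\<mu> = \<bottom>\<close> by simp
  also have "\<dots> \<doteq> (\<Sum>\<theta>\<in>joins S \<zeta> i. var \<theta>)"
    using face_cong_mult[OF joins_carrier var_bottom_cong] by (simp add: mult.commute)
  finally have "var \<eta> * (var \<zeta> * var i) \<doteq> var \<eta> * (\<Sum>\<theta>\<in>joins S \<zeta> i. var \<theta>)"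
    using face_cong_mult[OF var_in_face_poly_ring[OF \<eta>]] by blast
  also have "\<dots> = var \<eta> * var \<zeta>' + (\<Sum>\<theta>\<in>joins S \<zeta> i - {\<zeta>'}. var \<eta> * var \<theta>)"
    using join finite_joins by (simp add: sum.remove[of _ \<zeta>'] sum_distrib_left distrib_left)
  also have "\<dots> \<doteq> var \<eta> * var \<zeta>' + (\<Sum>\<theta>\<in>joins S \<zeta> i - {\<zeta>'}. 0)"
    using other by (intro face_cong_add face_cong_sum face_cong_refl) simp
  finally show ?thesis
    by simp
qed

text \<open>Adding the vertices of \<open>\<zeta>\<close> one at a time: on faces that contain \<open>\<eta>\<close>, the generator of a face
  of \<open>\<eta>\<close> behaves like the product of its vertices.\<close>

lemma var_mult_face_cong:
  assumes \<eta>: "\<eta> \<in> carrier S" and \<zeta>: "\<zeta> \<in> carrier S" "\<zeta> \<sqsubseteq> \<eta>"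
  shows "var \<eta> * var \<zeta> \<doteq> var \<eta> * (\<Prod>i\<in>vertices S \<zeta>. var i)"
proof -
  have "var \<eta> * var \<zeta> \<doteq> var \<eta> * (\<Prod>i\<in>A. var i)"
    if "finite A" "\<zeta> \<in> carrier S" "\<zeta> \<sqsubseteq> \<eta>" "vertices S \<zeta> = A" for A \<zeta>
    using that
  proof (induction A arbitrary: \<zeta> rule: finite_induct)
    case empty
    then have "\<zeta> = \<bottom>"
      using vertices_eqD[of \<zeta> \<zeta> \<bottom>] by simp
    then show ?case
      using face_cong_mult[OF var_in_face_poly_ring[OF \<eta>] var_bottom_cong] by simp
  next
    case (insert i A)
    have sub: "insert i A \<subseteq> vertices S \<eta>"
      using insert.prems vertices_mono[OF _ \<eta>, of \<zeta>] by simp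
    then obtain \<zeta>\<^sub>0 where \<zeta>\<^sub>0: "\<zeta>\<^sub>0 \<in> carrier S" "\<zeta>\<^sub>0 \<sqsubseteq> \<eta>" "vertices S \<zeta>\<^sub>0 = A"
      using face_with_vertices[OF \<eta>, of A] by auto
    have i: "i \<in> vertices S \<eta>" "i \<notin> vertices S \<zeta>\<^sub>0"
      using sub insert.hyps \<zeta>\<^sub>0(3) by simp_all
    have "var \<eta> * var \<zeta> \<doteq> var \<eta> * (var \<zeta>\<^sub>0 * var i)"
      by (rule face_cong_sym, rule var_mult_vertex_cong[OF \<eta> \<zeta>\<^sub>0(1,2) i insert.prems(1,2)])
        (simp add: insert.prems(3) \<zeta>\<^sub>0(3))
    also have "\<dots> = var i * (var \<eta> * var \<zeta>\<^sub>0)"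
      by (simp add: ac_simps)
    also have "\<dots> \<doteq> var i * (var \<eta> * (\<Prod>j\<in>A. var j))"
      by (intro face_cong_mult insert.IH \<zeta>\<^sub>0 var_vertex_in_face_poly_ring[OF i(1)])
    also have "\<dots> = var \<eta> * (\<Prod>j\<in>insert i A. var j)"
      using insert.hyps by (simp add: ac_simps)
    finally show ?case .
  qed
  with \<zeta> show ?thesis
    using vertices_finite by blast
qed

text \<open>The classes of these elements form a basis of the face ring. Linear independence is visible in
  the polynomial rings of the faces (\<open>face_eval_face_monom\<close>); generation is \<open>straightening\<close>.\<close>

definition face_monom :: "'a \<Rightarrow> ('a \<Rightarrow> nat) \<Rightarrow> 'a int_poly" where
  "face_monom \<sigma> b = var \<sigma> * (\<Prod>i\<in>vertices S \<sigma>. var i ^ b i)"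

lemma face_monom_carrier: "\<sigma> \<in> carrier S \<Longrightarrow> face_monom \<sigma> b \<in> carrier (face_poly_ring S)"
  unfolding face_monom_def using vertices_carrier by (intro face_poly_intros) auto

text \<open>In \<open>v\<^sub>\<tau> v\<^sub>\<sigma>\<close> the factor belonging to the meet of \<open>\<tau>\<close> and \<open>\<sigma>\<close> can be absorbed into the exponents,
  because each term of the sum contains some \<open>v\<^sub>\<eta>\<close> with \<open>\<eta>\<close> above the meet.\<close>

lemma var_mult_face_monom_cong:
  assumes \<sigma>: "\<sigma> \<in> carrier S" and \<tau>: "\<tau> \<in> carrier S"
  shows "\<exists>b'. var \<tau> * face_monom \<sigma> b \<doteq> (\<Sum>\<eta>\<in>joins S \<tau> \<sigma>. face_monom \<eta> b')"
proof
  (* The vertices of the meet of \<tau> and \<sigma> occur once more than in the given face monomial. *)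
  let ?b = "\<lambda>i. (if i \<in> vertices S \<sigma> then b i else 0) +
    (if i \<in> vertices S \<tau> \<inter> vertices S \<sigma> then 1 else 0)"
  let ?m = "\<Prod>i\<in>vertices S \<sigma>. var i ^ b i" and ?\<mu> = "the_elem (meets S \<tau> \<sigma>)"
  have m: "?m \<in> carrier (face_poly_ring S)"
    using vertices_carrier by (intro face_poly_intros) auto
  have "var \<tau> * face_monom \<sigma> b = ?m * (var \<tau> * var \<sigma>)"
    by (simp add: face_monom_def ac_simps)
  also have "\<dots> \<doteq> ?m * (var ?\<mu> * (\<Sum>\<eta>\<in>joins S \<tau> \<sigma>. var \<eta>))"
    by (rule face_cong_mult[OF m var_mult_cong[OF \<tau> \<sigma>]])
  also have "\<dots> = (\<Sum>\<eta>\<in>joins S \<tau> \<sigma>. ?m * (var \<eta> * var ?\<mu>))"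
    by (simp add: sum_distrib_left ac_simps)
  also have "\<dots> \<doteq> (\<Sum>\<eta>\<in>joins S \<tau> \<sigma>. face_monom \<eta> ?b)"
  proof (rule face_cong_sum)
    fix \<eta> assume join: "\<eta> \<in> joins S \<tau> \<sigma>"
    note \<eta> = joins_subset[OF \<tau> \<sigma> join]
    obtain \<mu> where \<mu>: "\<mu> \<in> carrier S" "meets S \<tau> \<sigma> = {\<mu>}" "\<mu> \<sqsubseteq> \<sigma>"
      "vertices S \<mu> = vertices S \<tau> \<inter> vertices S \<sigma>"
      using meets_below[OF \<tau> \<eta>(2) \<sigma> \<eta>(3,1)] by blast
    have "\<mu> \<sqsubseteq> \<eta>"
      using le_trans[OF \<mu>(3) \<eta>(3) \<mu>(1) \<sigma> \<eta>(1)] .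
    have sub: "vertices S \<sigma> \<subseteq> vertices S \<eta>" "vertices S \<tau> \<inter> vertices S \<sigma> \<subseteq> vertices S \<eta>"
      using vertices_join[OF \<tau> \<sigma> join] by auto
    have "?m = (\<Prod>i\<in>vertices S \<eta>. var i ^ (if i \<in> vertices S \<sigma> then b i else 0))"
      using sub by (intro prod.mono_neutral_cong_left vertices_finite) auto
    moreover have "(\<Prod>i\<in>vertices S \<mu>. var i) =
        (\<Prod>i\<in>vertices S \<eta>. var i ^ (if i \<in> vertices S \<tau> \<inter> vertices S \<sigma> then 1 else 0))"
      unfolding \<mu>(4) using sub by (intro prod.mono_neutral_cong_left vertices_finite) auto
    ultimately have "face_monom \<eta> ?b = ?m * (var \<eta> * (\<Prod>i\<in>vertices S \<mu>. var i))"
      by (simp only: face_monom_def power_add prod.distrib ac_simps)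
    then show "?m * (var \<eta> * var ?\<mu>) \<doteq> face_monom \<eta> ?b"
      using face_cong_mult[OF m var_mult_face_cong[OF \<eta>(1) \<mu>(1) \<open>\<mu> \<sqsubseteq> \<eta>\<close>]] \<mu>(2) by simp
  qed
  finally show "var \<tau> * face_monom \<sigma> b \<doteq> (\<Sum>\<eta>\<in>joins S \<tau> \<sigma>. face_monom \<eta> ?b)" .
qed

text \<open>The polynomials whose class is an integer combination of face monomials. Closure under addition
  is a rule, so that additive statements can be proved by induction.\<close>

inductive_set straight :: "'a int_poly set" where
  ideal: "f \<in> face_ideal S \<Longrightarrow> f \<in> straight"
| monom: "\<sigma> \<in> carrier S \<Longrightarrow> of_int c * face_monom \<sigma> b \<in> straight"
| add: "f \<in> straight \<Longrightarrow> g \<in> straight \<Longrightarrow> f + g \<in> straight"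

lemma straight_sum:
  "(\<And>x. x \<in> A \<Longrightarrow> f x \<in> straight) \<Longrightarrow> sum f A \<in> straight"
  by (induction A rule: infinite_finite_induct)
    (auto intro: straight.add straight.ideal face_ideal_zero)

lemma straight_cong: "f \<doteq> g \<Longrightarrow> g \<in> straight \<Longrightarrow> f \<in> straight"
  using straight.add[OF straight.ideal, of "f - g" g] by (simp add: face_cong_def)

lemma straight_var_mult:
  assumes "f \<in> straight" and \<tau>: "\<tau> \<in> carrier S"
  shows "var \<tau> * f \<in> straight"
  using assms(1)
proof induction
  case (ideal f)
  then show ?case
    using face_ideal_mult var_in_face_poly_ring[OF \<tau>] by (blast intro: straight.ideal)
next
  case (monom \<sigma> c b)
  obtain b' where "var \<tau> * face_monom \<sigma> b \<doteq> (\<Sum>\<eta>\<in>joins S \<tau> \<sigma>. face_monom \<eta> b')"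
    using var_mult_face_monom_cong[OF monom \<tau>] by blast
  from face_cong_mult[OF of_int_in_face_poly_ring this, of c]
  have "var \<tau> * (of_int c * face_monom \<sigma> b) \<doteq> (\<Sum>\<eta>\<in>joins S \<tau> \<sigma>. of_int c * face_monom \<eta> b')"
    by (simp add: ac_simps sum_distrib_left)
  then show ?case
    by (rule straight_cong) (intro straight_sum straight.monom joins_subset(1)[OF \<tau> monom])
next
  case (add f g)
  then show ?case
    by (simp add: distrib_left straight.add)
qed

text \<open>The face monomials span the face ring: the generator of the initial element is a face monomial
  congruent to \<open>1\<close>, and the span is stable under multiplication by all generators.\<close>

lemma straightening:
  assumes "f \<in> carrier (face_poly_ring S)"
  shows "f \<in> straight"
proof -
  have mult_power: "var \<sigma> ^ n * f \<in> straight" if "\<sigma> \<in> carrier S" "f \<in> straight" for \<sigma> n f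
    using that by (induction n) (simp_all add: mult.assoc straight_var_mult)
  have mult_prod: "(\<Prod>x\<in>A. var x ^ n x) * f \<in> straight"
    if "A \<subseteq> carrier S" "f \<in> straight" for A n f
    using that
    by (induction A rule: infinite_finite_induct) (simp_all add: mult.assoc mult_power)
  have of_int: "of_int c \<in> straight" for c
  proof (rule straight_cong)
    show "of_int c \<doteq> of_int c * face_monom \<bottom> (\<lambda>_. 0)"
      using face_cong_mult[OF of_int_in_face_poly_ring face_cong_sym[OF var_bottom_cong], of c]
      by (simp add: face_monom_def)
  qed (intro straight.monom bottom_closed)
  have "(\<Sum>m\<in>keys f. single m (lookup f m)) \<in> straight"
  proof (rule straight_sum)
    fix m assume "m \<in> keys f"
    then have "keys m \<subseteq> carrier S"
      using assms by (simp add: face_poly_ring_def carrier_int_poly_ring)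
    from mult_prod[OF this of_int] show "single m (lookup f m) \<in> straight"
      by (simp add: single_eq_monom_val_var[of m] monom_val_def mult.commute)
  qed
  then show ?thesis
    by (simp add: sum_single_keys)
qed

section \<open>The face ring as a ring of compatible families\<close>

definition face_value :: "'a \<Rightarrow> 'a \<Rightarrow> 'a int_poly" where
  "face_value \<rho> \<tau> = (if \<tau> \<sqsubseteq> \<rho> then \<Prod>i\<in>vertices S \<tau>. var i else 0)"

abbreviation face_eval :: "'a \<Rightarrow> 'a int_poly \<Rightarrow> 'a int_poly" where
  "face_eval \<rho> \<equiv> poly_subst (face_value \<rho>)"

lemma face_value_piece:
  assumes "\<rho> \<in> carrier S" "\<tau> \<in> carrier S"
  shows "face_value \<rho> \<tau> \<in> piece (simplex_poly_ring S \<rho>) (int (2 * rank S \<tau>))"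
proof (cases "\<tau> \<sqsubseteq> \<rho>")
  case True
  have "(\<Prod>i\<in>vertices S \<tau>. var i) \<in> piece (simplex_poly_ring S \<rho>) (\<Sum>i\<in>vertices S \<tau>. 2)"
    unfolding simplex_poly_ring_def using vertices_mono[OF assms(2,1) True]
    by (intro piece_prod piece_var vertices_finite) auto
  with True card_vertices[OF assms(2)] show ?thesis
    by (simp add: face_value_def mult.commute)
qed (simp add: face_value_def simplex_poly_ring_def piece_zero)

lemma face_eval_graded_hom:
  assumes "\<rho> \<in> carrier S"
  shows "face_eval \<rho> \<in> graded_hom (face_poly_ring S) (simplex_poly_ring S \<rho>)"
  using face_value_piece[OF assms] unfolding face_poly_ring_def simplex_poly_ring_def
  by (intro poly_subst_graded_hom) simp

lemma restrict_eq_filter: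
  "simplex_poly_restrict S \<sigma> \<tau> = lin_ext (\<lambda>m. if keys m \<subseteq> vertices S \<sigma> then single m 1 else 0)"
proof -
  have "monom_val (\<lambda>i. if i \<in> vertices S \<sigma> then var i else 0) =
      (\<lambda>m. if keys m \<subseteq> vertices S \<sigma> then single m (1::int) else 0)"
  proof (rule ext, goal_cases)
    case (1 m)
    show ?case
    proof (cases "keys m \<subseteq> vertices S \<sigma>")
      case True
      then show ?thesis
        using single_eq_monom_val_var[of m 1] unfolding monom_val_def
        by (simp add: subset_iff cong: prod.cong)
    next
      case False
      then obtain i where "i \<in> keys m" "i \<notin> vertices S \<sigma>"
        by blast
      then show ?thesis
        using False unfolding monom_val_def
        by (auto simp: in_keys_iff zero_power intro!: prod_zero bexI[of _ i])
    qed
  qed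
  then show ?thesis
    by (simp add: simplex_poly_restrict_def poly_subst_lin_ext)
qed

lemma lookup_restrict:
  "lookup (simplex_poly_restrict S \<sigma> \<tau> f) m = (if keys m \<subseteq> vertices S \<sigma> then lookup f m else 0)"
  by (simp add: restrict_eq_filter lookup_lin_ext_filter)

lemma restrict_face_eval:
  assumes "\<sigma> \<in> carrier S" "\<tau> \<in> carrier S" "\<sigma> \<sqsubseteq> \<tau>" "f \<in> carrier (face_poly_ring S)"
  shows "simplex_poly_restrict S \<sigma> \<tau> (face_eval \<tau> f) = face_eval \<sigma> f"
  unfolding simplex_poly_restrict_def poly_subst_compose
proof (rule poly_subst_cong)
  fix m \<theta> assume "m \<in> keys f" "\<theta> \<in> keys m"
  with assms(4) have \<theta>: "\<theta> \<in> carrier S"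
    by (auto simp: face_poly_ring_def carrier_int_poly_ring)
  let ?r = "\<lambda>i. if i \<in> vertices S \<sigma> then var i else 0"
  show "poly_subst ?r (face_value \<tau> \<theta>) = face_value \<sigma> \<theta>"
  proof (cases "\<theta> \<sqsubseteq> \<sigma>")
    case True
    then have "\<theta> \<sqsubseteq> \<tau>"
      using le_trans[OF True assms(3) \<theta> assms(1,2)] by simp
    with True vertices_mono[OF \<theta> assms(1) True] show ?thesis
      by (auto simp: face_value_def poly_subst_prod intro!: prod.cong)
  next
    case False
    show ?thesis
    proof (cases "\<theta> \<sqsubseteq> \<tau>")
      case True
      with False obtain i where "i \<in> vertices S \<theta>" "i \<notin> vertices S \<sigma>"
        using le_iff_vertices[OF assms(2) \<theta> True assms(1,3)] by blast
      then have "(\<Prod>i\<in>vertices S \<theta>. ?r i) = 0"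
        by (intro prod_zero vertices_finite bexI[of _ i]) simp_all
      with True False show ?thesis
        by (simp add: face_value_def poly_subst_prod)
    qed (use False in \<open>simp add: face_value_def\<close>)
  qed
qed

text \<open>If \<open>\<sigma>\<close> and \<open>\<tau>\<close> are faces of \<open>\<rho>\<close>, exactly one of their joins is, and the relation says that the
  product over two sets of vertices is the product over their intersection times the product over
  their union. Otherwise no join is a face of \<open>\<rho>\<close> and both sides vanish.\<close>

lemma face_eval_relation:
  assumes \<rho>: "\<rho> \<in> carrier S" and f: "f \<in> face_relations S"
  shows "face_eval \<rho> f = 0"
proof -
  have "face_value \<rho> \<sigma> * face_value \<rho> \<tau> =
      face_value \<rho> (the_elem (meets S \<sigma> \<tau>)) * (\<Sum>\<eta> \<in> joins S \<sigma> \<tau>. face_value \<rho> \<eta>)"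
    if \<sigma>: "\<sigma> \<in> carrier S" and \<tau>: "\<tau> \<in> carrier S" for \<sigma> \<tau>
  proof (cases "\<sigma> \<sqsubseteq> \<rho> \<and> \<tau> \<sqsubseteq> \<rho>")
    case True
    then have le: "\<sigma> \<sqsubseteq> \<rho>" "\<tau> \<sqsubseteq> \<rho>"
      by simp_all
    obtain \<mu> where \<mu>: "\<mu> \<in> carrier S" "meets S \<sigma> \<tau> = {\<mu>}" "\<mu> \<sqsubseteq> \<sigma>"
      "vertices S \<mu> = vertices S \<sigma> \<inter> vertices S \<tau>"
      using meets_below[OF \<sigma> le(1) \<tau> le(2) \<rho>] by blast
    have "\<mu> \<sqsubseteq> \<rho>"
      using le_trans[OF \<mu>(3) le(1) \<mu>(1) \<sigma> \<rho>] .
    obtain \<eta> where \<eta>: "{\<zeta> \<in> joins S \<sigma> \<tau>. \<zeta> \<sqsubseteq> \<rho>} = {\<eta>}"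
      "vertices S \<eta> = vertices S \<sigma> \<union> vertices S \<tau>"
      using ex1_join_below[OF \<sigma> le(1) \<tau> le(2) \<rho>] by blast
    have "(\<Sum>\<zeta>\<in>joins S \<sigma> \<tau>. face_value \<rho> \<zeta>) = (\<Sum>\<zeta>\<in>{\<eta>}. face_value \<rho> \<zeta>)"
      unfolding \<eta>(1)[symmetric] using finite_joins
      by (intro sum.mono_neutral_right) (auto simp: face_value_def)
    also have "\<dots> = (\<Prod>i\<in>vertices S \<sigma> \<union> vertices S \<tau>. var i)"
      using \<eta> by (simp add: face_value_def) blast
    finally show ?thesis
      using le \<mu> \<open>\<mu> \<sqsubseteq> \<rho>\<close> prod.union_inter[OF vertices_finite vertices_finite, of var \<sigma> \<tau>]
      by (simp add: face_value_def mult.commute)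
  next
    case False
    have "face_value \<rho> \<eta> = 0" if "\<eta> \<in> joins S \<sigma> \<tau>" for \<eta>
    proof -
      note \<eta> = joins_subset[OF \<sigma> \<tau> that]
      have "\<not> \<eta> \<sqsubseteq> \<rho>"
        using False le_trans[OF \<eta>(2) _ \<sigma> \<eta>(1) \<rho>] le_trans[OF \<eta>(3) _ \<tau> \<eta>(1) \<rho>] by blast
      then show ?thesis
        by (simp add: face_value_def)
    qed
    with False show ?thesis
      by (auto simp: face_value_def)
  qed
  with f \<rho> show ?thesis
    by (auto simp: face_relations_def poly_subst_diff poly_subst_mult poly_subst_sum face_value_def)
qed

lemma face_eval_ideal:
  assumes \<rho>: "\<rho> \<in> carrier S" and f: "f \<in> face_ideal S"
  shows "face_eval \<rho> f = 0"
proof -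
  let ?K = "{f \<in> carrier (face_poly_ring S). face_eval \<rho> f = 0}"
  interpret F: cring "face_poly_ring S"
    by (rule cring_face_poly_ring)
  have "ideal ?K (face_poly_ring S)"
  proof (rule idealI)
    show "subgroup ?K (add_monoid (face_poly_ring S))"
    proof (rule F.add.subgroupI)
      fix f assume f: "f \<in> ?K"
      then have "\<ominus>\<^bsub>face_poly_ring S\<^esub> f = 0 - f"
        unfolding face_poly_ring_def by (subst a_inv_int_poly_ring) auto
      with f show "\<ominus>\<^bsub>face_poly_ring S\<^esub> f \<in> ?K"
        using F.a_inv_closed[of f] by (simp add: poly_subst_diff del: diff_0)
    qed (auto simp: poly_subst_add face_poly_intros)
  qed (auto simp: poly_subst_mult face_poly_intros intro: F.ring_axioms)
  moreover have "face_relations S \<subseteq> ?K"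
    using face_eval_relation[OF \<rho>] face_relations_carrier by blast
  ultimately have "face_ideal S \<subseteq> ?K"
    unfolding face_ideal_def by (rule F.genideal_minimal)
  with f show ?thesis
    by blast
qed

lemma face_eval_cong: "\<rho> \<in> carrier S \<Longrightarrow> f \<doteq> g \<Longrightarrow> face_eval \<rho> f = face_eval \<rho> g"
  using face_eval_ideal[of \<rho> "f - g"] by (simp add: face_cong_def poly_subst_diff)

text \<open>In a compatible family the values on proper faces of \<open>\<sigma>\<close> determine the value at \<open>\<sigma>\<close> except for
  the monomials in which every vertex of \<open>\<sigma>\<close> occurs. Such a monomial \<open>m\<close> is the product of the vertices
  of \<open>\<sigma>\<close> times a smaller monomial, so it is the value at \<open>\<sigma>\<close> of a face monomial with leading factor
  \<open>v\<^sub>\<sigma>\<close>, which vanishes on all faces that do not contain \<open>\<sigma>\<close>.\<close>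

definition lift_monom :: "'a \<Rightarrow> ('a \<Rightarrow>\<^sub>0 nat) \<Rightarrow> 'a int_poly" where
  "lift_monom \<sigma> m = (if keys m = vertices S \<sigma> then face_monom \<sigma> (\<lambda>i. lookup m i - 1) else 0)"

text \<open>Inverse to \<open>f \<mapsto> (\<lambda>\<rho>. face_eval \<rho> f)\<close> up to the
  face ideal on one side (\<open>face_section_face_eval\<close>), and on compatible families on the other side
  (\<open>face_eval_face_section\<close>).\<close>

definition face_section :: "('a \<Rightarrow> 'a int_poly) \<Rightarrow> 'a int_poly" where
  "face_section f = (\<Sum>\<sigma>\<in>carrier S. lin_ext (lift_monom \<sigma>) (f \<sigma>))"

lemma face_section_add: "face_section (\<lambda>\<sigma>. f \<sigma> + g \<sigma>) = face_section f + face_section g"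
  by (simp add: face_section_def lin_ext_add sum.distrib)

lemma face_section_cong: "(\<And>\<sigma>. \<sigma> \<in> carrier S \<Longrightarrow> f \<sigma> = g \<sigma>) \<Longrightarrow> face_section f = face_section g"
  by (simp add: face_section_def)

lemma face_eval_face_monom:
  assumes "\<rho> \<in> carrier S" "\<sigma> \<in> carrier S"
  shows "face_eval \<rho> (face_monom \<sigma> b) =
    (if \<sigma> \<sqsubseteq> \<rho> then single (\<Sum>i\<in>vertices S \<sigma>. single i (Suc (b i))) 1 else 0)"
proof (cases "\<sigma> \<sqsubseteq> \<rho>")
  case True
  have vertex_value: "face_value \<rho> i = var i" if i: "i \<in> vertices S \<sigma>" for i
    using le_trans[OF vertex_le[OF i] True vertex_carrier[OF i] assms(2,1)] vertices_vertex[OF i]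
    by (simp add: face_value_def)
  have "face_eval \<rho> (face_monom \<sigma> b) = (\<Prod>i\<in>vertices S \<sigma>. var i ^ Suc (b i))"
    using True vertex_value
    by (simp add: face_monom_def poly_subst_mult poly_subst_prod poly_subst_power prod.distrib
        face_value_def[of \<rho> \<sigma>])
  also have "\<dots> = single (\<Sum>i\<in>vertices S \<sigma>. single i (Suc (b i))) 1"
    unfolding var_power prod_single_one ..
  finally show ?thesis
    using True by simp
qed (simp add: face_monom_def poly_subst_mult face_value_def[of \<rho> \<sigma>])

lemma face_section_face_monom:
  assumes \<sigma>: "\<sigma> \<in> carrier S"
  shows "face_section (\<lambda>\<rho>. face_eval \<rho> (of_int c * face_monom \<sigma> b)) = of_int c * face_monom \<sigma> b"
proof -
  define m where "m = (\<Sum>i\<in>vertices S \<sigma>. single i (Suc (b i)))"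
  have lookup_m: "lookup m i = (if i \<in> vertices S \<sigma> then Suc (b i) else 0)" for i
    by (simp add: m_def lookup_sum_single vertices_finite)
  then have keys_m: "keys m = vertices S \<sigma>"
    by (auto simp: in_keys_iff split: if_splits)
  have eval: "face_eval \<rho> (of_int c * face_monom \<sigma> b) = (if \<sigma> \<sqsubseteq> \<rho> then single m c else 0)"
    if "\<rho> \<in> carrier S" for \<rho>
  proof -
    have "of_int c * single m (1::int) = single m c"
      by (rule poly_mapping_eqI) (simp add: lookup_of_int_mult lookup_single when_def)
    then show ?thesis
      using face_eval_face_monom[OF that \<sigma>, of b] by (simp add: poly_subst_mult m_def)
  qed
  have other: "lin_ext (lift_monom \<rho>) (face_eval \<rho> (of_int c * face_monom \<sigma> b)) = 0"
    if \<rho>: "\<rho> \<in> carrier S" "\<rho> \<noteq> \<sigma>" for \<rho>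
  proof (cases "\<sigma> \<sqsubseteq> \<rho>")
    case True
    then have "keys m \<noteq> vertices S \<rho>"
      using vertices_eqD[OF \<rho>(1) \<sigma> True \<rho>(1)] \<rho> keys_m by auto
    then show ?thesis
      by (simp add: eval[OF \<rho>(1)] lift_monom_def)
  qed (simp add: eval[OF \<rho>(1)])
  have "face_section (\<lambda>\<rho>. face_eval \<rho> (of_int c * face_monom \<sigma> b)) =
      lin_ext (lift_monom \<sigma>) (face_eval \<sigma> (of_int c * face_monom \<sigma> b))"
    unfolding face_section_def using \<sigma> other finite_carrier
    by (subst sum.remove[of _ \<sigma>]) (simp_all add: sum.neutral)
  also have "\<dots> = of_int c * face_monom \<sigma> (\<lambda>i. lookup m i - 1)"
    using \<sigma> keys_m by (simp add: eval lift_monom_def)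
  also have "face_monom \<sigma> (\<lambda>i. lookup m i - 1) = face_monom \<sigma> b"
    by (simp add: face_monom_def lookup_m)
  finally show ?thesis .
qed

text \<open>Both sides are additive in \<open>f\<close> and respect congruence, so by \<open>straightening\<close> it suffices
  that they agree on multiples of face monomials.\<close>

lemma face_section_face_eval:
  assumes "f \<in> carrier (face_poly_ring S)"
  shows "face_section (\<lambda>\<rho>. face_eval \<rho> f) \<doteq> f"
  using straightening[OF assms]
proof induction
  case (ideal f)
  have "face_section (\<lambda>\<rho>. face_eval \<rho> f) = face_section (\<lambda>\<rho>. 0)"
    using face_eval_ideal ideal by (intro face_section_cong) simp
  with face_ideal_uminus[OF ideal] show ?case
    by (simp add: face_section_def face_cong_def)
next
  case (monom \<sigma> c b)
  then show ?case
    by (simp add: face_section_face_monom)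
next
  case (add f g)
  then show ?case
    by (simp add: poly_subst_add face_section_add face_cong_add)
qed

lemma face_eval_inject:
  assumes "f \<in> carrier (face_poly_ring S)" "g \<in> carrier (face_poly_ring S)"
    and "\<And>\<rho>. \<rho> \<in> carrier S \<Longrightarrow> face_eval \<rho> f = face_eval \<rho> g"
  shows "f \<doteq> g"
proof -
  have "f \<doteq> face_section (\<lambda>\<rho>. face_eval \<rho> f)"
    by (rule face_cong_sym[OF face_section_face_eval[OF assms(1)]])
  also have "\<dots> = face_section (\<lambda>\<rho>. face_eval \<rho> g)"
    using assms(3) by (rule face_section_cong)
  also have "\<dots> \<doteq> g"
    by (rule face_section_face_eval[OF assms(2)])
  finally show ?thesis .
qed

lemma face_eval_lift_monom:
  assumes "\<rho> \<in> carrier S" "\<sigma> \<in> carrier S"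
  shows "face_eval \<rho> (lift_monom \<sigma> m) =
    (if keys m = vertices S \<sigma> \<and> \<sigma> \<sqsubseteq> \<rho> then single m 1 else 0)"
proof (cases "keys m = vertices S \<sigma>")
  case True
  have "(\<Sum>i\<in>vertices S \<sigma>. single i (Suc (lookup m i - 1))) = m"
    unfolding True[symmetric]
    by (rule poly_mapping_eqI) (auto simp: lookup_sum_single in_keys_iff)
  with True show ?thesis
    by (simp add: lift_monom_def face_eval_face_monom[OF assms])
qed (simp add: lift_monom_def)

text \<open>A monomial \<open>m\<close> in vertices of \<open>\<rho>\<close> has exactly one face \<open>\<sigma>\<close> of \<open>\<rho>\<close> as its support; only the summand of
  \<open>\<sigma>\<close> contributes to the coefficient of \<open>m\<close> at \<open>\<rho>\<close>, and by compatibility it contributes the correct one.\<close>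

lemma face_eval_face_section:
  assumes \<rho>: "\<rho> \<in> carrier S"
    and carrier: "f \<rho> \<in> carrier (simplex_poly_ring S \<rho>)"
    and compat: "\<And>\<sigma>. \<sigma> \<in> carrier S \<Longrightarrow> \<sigma> \<sqsubseteq> \<rho> \<Longrightarrow> simplex_poly_restrict S \<sigma> \<rho> (f \<rho>) = f \<sigma>"
  shows "face_eval \<rho> (face_section f) = f \<rho>"
proof (rule poly_mapping_eqI)
  fix m
  have "lookup (face_eval \<rho> (face_section f)) m =
      (\<Sum>\<sigma>\<in>carrier S. if keys m = vertices S \<sigma> \<and> \<sigma> \<sqsubseteq> \<rho> then lookup (f \<sigma>) m else 0)"
    by (simp add: face_section_def poly_subst_sum poly_subst_lin_ext_comp lookup_sum
        face_eval_lift_monom[OF \<rho>] lookup_lin_ext_filter cong: sum.cong)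
  also have "\<dots> = lookup (f \<rho>) m"
  proof (cases "keys m \<subseteq> vertices S \<rho>")
    case True
    then obtain \<sigma> where \<sigma>: "\<sigma> \<in> carrier S" "\<sigma> \<sqsubseteq> \<rho>" "vertices S \<sigma> = keys m"
      using face_with_vertices[OF \<rho>] by blast
    have "keys m = vertices S \<tau> \<and> \<tau> \<sqsubseteq> \<rho> \<longleftrightarrow> \<tau> = \<sigma>" if "\<tau> \<in> carrier S" for \<tau>
      using vertices_eqD[OF \<rho> that _ \<sigma>(1,2)] \<sigma> by auto
    then have "(\<Sum>\<tau>\<in>carrier S. if keys m = vertices S \<tau> \<and> \<tau> \<sqsubseteq> \<rho> then lookup (f \<tau>) m else 0) =
        (\<Sum>\<tau>\<in>carrier S. if \<tau> = \<sigma> then lookup (f \<tau>) m else 0)"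
      by (intro sum.cong) auto
    also have "\<dots> = lookup (f \<sigma>) m"
      using \<sigma>(1) finite_carrier by simp
    also have "\<dots> = lookup (f \<rho>) m"
      using lookup_restrict[of \<sigma> \<rho> "f \<rho>" m] compat[OF \<sigma>(1,2)] \<sigma>(3) by simp
    finally show ?thesis .
  next
    case False
    have "(\<Sum>\<sigma>\<in>carrier S. if keys m = vertices S \<sigma> \<and> \<sigma> \<sqsubseteq> \<rho> then lookup (f \<sigma>) m else 0) = 0"
      using False vertices_mono[OF _ \<rho>] by (intro sum.neutral) auto
    moreover have "lookup (f \<rho>) m = 0"
      using False carrier by (auto simp: simplex_poly_ring_def carrier_int_poly_ring in_keys_iff)
    ultimately show ?thesis
      by simp
  qed
  finally show "lookup (face_eval \<rho> (face_section f)) m = lookup (f \<rho>) m" .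
qed

lemma face_section_carrier: "face_section f \<in> carrier (face_poly_ring S)"
  unfolding face_section_def lin_ext_def
  by (intro face_poly_intros) (simp_all add: lift_monom_def face_monom_carrier face_poly_intros)

lemma face_section_piece:
  assumes "\<And>\<sigma>. \<sigma> \<in> carrier S \<Longrightarrow> f \<sigma> \<in> piece (simplex_poly_ring S \<sigma>) d"
  shows "face_section f \<in> piece (face_poly_ring S) d"
  unfolding face_section_def lin_ext_def face_poly_ring_def
proof (intro piece_sum piece_scale)
  fix \<sigma> m assume \<sigma>: "\<sigma> \<in> carrier S" and m: "m \<in> keys (f \<sigma>)"
  let ?P = "int_poly_ring (carrier S) (\<lambda>\<sigma>. 2 * rank S \<sigma>)"
  show "lift_monom \<sigma> m \<in> piece ?P d"
  proof (cases "keys m = vertices S \<sigma>")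
    case True
    have "face_monom \<sigma> (\<lambda>i. lookup m i - 1) \<in>
        piece ?P (int (2 * rank S \<sigma>) + (\<Sum>i\<in>vertices S \<sigma>. int (lookup m i - 1) * 2))"
      unfolding face_monom_def using \<sigma>
      by (intro piece_mult piece_prod piece_power piece_var vertices_finite)
        (simp_all add: vertex_carrier rank_vertex)
    also have "int (2 * rank S \<sigma>) = (\<Sum>i\<in>vertices S \<sigma>. 2)"
      using card_vertices[OF \<sigma>] by simp
    also have "\<dots> + (\<Sum>i\<in>vertices S \<sigma>. int (lookup m i - 1) * 2) =
        (\<Sum>i\<in>vertices S \<sigma>. int (2 * lookup m i))"
      unfolding sum.distrib[symmetric] True[symmetric]
      by (intro sum.cong) (auto simp: in_keys_iff of_nat_diff)
    also have "\<dots> = d"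
      using assms[OF \<sigma>] m True
      by (auto simp: simplex_poly_ring_def piece_int_poly_ring weighted_degree_def)
    finally show ?thesis
      using True by (simp add: lift_monom_def)
  qed (simp add: lift_monom_def piece_zero)
qed

section \<open>The face ring as a graded ring\<close>

definition face_class :: "'a int_poly \<Rightarrow> 'a int_poly set" where
  "face_class f = face_ideal S +>\<^bsub>face_poly_ring S\<^esub> f"

lemma mem_face_class: "g \<in> face_class f \<longleftrightarrow> g \<doteq> f"
proof
  assume "g \<in> face_class f"
  then show "g \<doteq> f"
    by (auto simp: face_class_def a_r_coset_def' face_cong_def)
next
  assume "g \<doteq> f"
  then show "g \<in> face_class f"
    by (auto simp: face_class_def a_r_coset_def' face_cong_def intro!: bexI[of _ "g - f"])
qed

lemma face_class_eq_iff: "face_class f = face_class g \<longleftrightarrow> f \<doteq> g"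
proof
  assume "face_class f = face_class g"
  then show "f \<doteq> g"
    using mem_face_class[of f f] mem_face_class[of f g] by simp
next
  assume "f \<doteq> g"
  then show "face_class f = face_class g"
    using face_cong_trans[of _ f g] face_cong_trans[of _ g f] face_cong_sym[of f g]
    by (intro equalityI subsetI) (auto simp only: mem_face_class)
qed

lemma carrier_face_ring: "carrier (face_ring S) = face_class ` carrier (face_poly_ring S)"
  by (auto simp: face_ring_def ring.defs FactRing_def A_RCOSETS_def' face_class_def)

lemma piece_face_ring: "piece (face_ring S) d = face_class ` piece (face_poly_ring S) d"
  by (simp add: face_ring_def ring.defs face_class_def[abs_def])

lemma one_face_ring: "\<one>\<^bsub>face_ring S\<^esub> = face_class 1"
  by (simp add: face_ring_def ring.defs FactRing_def face_class_def)

lemma zero_face_ring: "\<zero>\<^bsub>face_ring S\<^esub> = face_class 0"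
  by (auto simp: face_ring_def ring.defs FactRing_def face_class_def a_r_coset_def')

lemma face_class_mult:
  assumes "f \<in> carrier (face_poly_ring S)" "g \<in> carrier (face_poly_ring S)"
  shows "face_class f \<otimes>\<^bsub>face_ring S\<^esub> face_class g = face_class (f * g)"
  using ideal.rcoset_mult_add[OF ideal_face_ideal assms]
  by (simp add: face_ring_def ring.defs FactRing_def face_class_def)

lemma face_class_add:
  assumes "f \<in> carrier (face_poly_ring S)" "g \<in> carrier (face_poly_ring S)"
  shows "face_class f \<oplus>\<^bsub>face_ring S\<^esub> face_class g = face_class (f + g)"
proof -
  interpret ideal "face_ideal S" "face_poly_ring S"
    by (rule ideal_face_ideal)
  show ?thesis
    using a_rcos_sum[OF assms] by (simp add: face_ring_def ring.defs FactRing_def face_class_def)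
qed

lemma cring_face_ring: "cring (face_ring S)"
proof (rule cringI)
  show "abelian_group (face_ring S)"
  proof (rule abelian_groupI)
    fix x assume "x \<in> carrier (face_ring S)"
    then obtain f where f: "f \<in> carrier (face_poly_ring S)" "x = face_class f"
      by (auto simp: carrier_face_ring)
    then have "face_class (- f) \<in> carrier (face_ring S)"
      "face_class (- f) \<oplus>\<^bsub>face_ring S\<^esub> x = \<zero>\<^bsub>face_ring S\<^esub>"
      by (simp_all add: carrier_face_ring face_class_add zero_face_ring face_poly_intros)
    then show "\<exists>y\<in>carrier (face_ring S). y \<oplus>\<^bsub>face_ring S\<^esub> x = \<zero>\<^bsub>face_ring S\<^esub>"
      by blast
  qed (auto simp: carrier_face_ring face_class_add zero_face_ring face_poly_intros ac_simps)
  show "comm_monoid (face_ring S)"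
    by (rule comm_monoidI)
      (auto simp: carrier_face_ring face_class_mult one_face_ring face_poly_intros ac_simps)
qed (auto simp: carrier_face_ring face_class_mult face_class_add face_poly_intros algebra_simps)

lemma face_class_hom: "ring_hom_cring (face_poly_ring S) (face_ring S) face_class"
  by (intro ring_hom_cring.intro ring_hom_cring_axioms.intro cring_face_poly_ring cring_face_ring
      ring_hom_memI) (auto simp: carrier_face_ring face_class_mult face_class_add one_face_ring)

lemma face_ring_proj_class:
  assumes "\<rho> \<in> carrier S"
  shows "face_ring_proj S \<rho> (face_class f) = face_eval \<rho> f"
proof -
  have "face_eval \<rho> ` face_class f = {face_eval \<rho> f}"
    using face_eval_cong[OF assms] by (force simp: mem_face_class intro!: image_eqI[of _ _ f])
  then show ?thesis
    by (simp add: face_ring_proj_def face_value_def[abs_def])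
qed

lemma face_ring_proj_graded_hom:
  assumes "\<rho> \<in> carrier S"
  shows "face_ring_proj S \<rho> \<in> graded_hom (face_ring S) (simplex_poly_ring S \<rho>)"
  using face_eval_graded_hom[OF assms] unfolding graded_hom_def
  by (auto simp: piece_face_ring carrier_face_ring face_ring_proj_class[OF assms] ring_hom_def
      image_subset_iff face_class_mult face_class_add one_face_ring)

lemma face_ring_proj_inject:
  assumes "x \<in> carrier (face_ring S)" "y \<in> carrier (face_ring S)"
    and "\<And>\<rho>. \<rho> \<in> carrier S \<Longrightarrow> face_ring_proj S \<rho> x = face_ring_proj S \<rho> y"
  shows "x = y"
proof -
  obtain f g where fg: "f \<in> carrier (face_poly_ring S)" "x = face_class f"
    "g \<in> carrier (face_poly_ring S)" "y = face_class g"
    using assms(1,2) by (auto simp: carrier_face_ring)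
  with assms(3) have "f \<doteq> g"
    by (intro face_eval_inject) (simp_all add: face_ring_proj_class)
  with fg show ?thesis
    by (simp add: face_class_eq_iff)
qed

lemma is_graded_ring_simplex_poly_ring: "is_graded_ring (simplex_poly_ring S \<sigma>)"
  by (simp add: simplex_poly_ring_def is_graded_ring_int_poly_ring)

lemma piece_face_ring_carrier: "piece (face_ring S) d \<subseteq> carrier (face_ring S)"
  using piece_subset_carrier[of "carrier S" "\<lambda>\<sigma>. 2 * rank S \<sigma>" d]
  by (auto simp: piece_face_ring carrier_face_ring face_poly_ring_def)

lemma additive_subgroup_piece_face_ring:
  "additive_subgroup (piece (face_ring S) d) (face_ring S)"
proof -
  interpret L: cring "face_ring S"
    by (rule cring_face_ring)
  note intros = piece_add[where X = "carrier S" and w = "\<lambda>\<sigma>. 2 * rank S \<sigma>", folded face_poly_ring_def]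
    piece_zero[where X = "carrier S" and w = "\<lambda>\<sigma>. 2 * rank S \<sigma>", folded face_poly_ring_def]
    piece_uminus[where X = "carrier S" and w = "\<lambda>\<sigma>. 2 * rank S \<sigma>", folded face_poly_ring_def]
  have sub: "f \<in> carrier (face_poly_ring S)" if "f \<in> piece (face_poly_ring S) d" for f
    using that piece_subset_carrier unfolding face_poly_ring_def by blast
  show ?thesis
  proof (intro additive_subgroup.intro L.add.subgroupI)
    show "piece (face_ring S) d \<subseteq> carrier (face_ring S)"
      by (rule piece_face_ring_carrier)
    show "piece (face_ring S) d \<noteq> {}"
      using intros(2)[of d] by (auto simp: piece_face_ring)
  next
    fix x assume "x \<in> piece (face_ring S) d"
    then obtain f where f: "f \<in> piece (face_poly_ring S) d" "x = face_class f"
      by (auto simp: piece_face_ring)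
    have "\<ominus>\<^bsub>face_ring S\<^esub> x = face_class (- f)"
      using f sub[OF f(1)]
      by (intro L.minus_equality)
        (simp_all add: carrier_face_ring face_class_add zero_face_ring face_poly_intros)
    with f show "\<ominus>\<^bsub>face_ring S\<^esub> x \<in> piece (face_ring S) d"
      by (simp add: piece_face_ring intros(3))
  next
    fix x y assume "x \<in> piece (face_ring S) d" "y \<in> piece (face_ring S) d"
    then show "x \<oplus>\<^bsub>face_ring S\<^esub> y \<in> piece (face_ring S) d"
      using sub intros(1) by (auto simp: piece_face_ring face_class_add)
  qed
qed

lemma face_ring_decomposition_exists:
  assumes "x \<in> carrier (face_ring S)"
  shows "\<exists>f. (\<forall>d. f d \<in> piece (face_ring S) d) \<and> finite {d. f d \<noteq> \<zero>\<^bsub>face_ring S\<^esub>} \<and>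
    x = finsum (face_ring S) f {d. f d \<noteq> \<zero>\<^bsub>face_ring S\<^esub>}"
proof -
  let ?P = "face_poly_ring S" and ?L = "face_ring S"
  interpret C: ring_hom_cring ?P ?L face_class
    by (rule face_class_hom)
  obtain f where f: "f \<in> carrier ?P" "x = face_class f"
    using assms by (auto simp: carrier_face_ring)
  have "is_graded_ring ?P"
    by (simp add: face_poly_ring_def is_graded_ring_int_poly_ring)
  with f(1) obtain p where p: "\<And>d. p d \<in> piece ?P d" "finite {d. p d \<noteq> 0}"
    "f = finsum ?P p {d. p d \<noteq> 0}"
    unfolding is_graded_ring_def by (metis face_poly_ring_ops(4))
  have p_carrier: "p d \<in> carrier ?P" for d
    using p(1)[of d] piece_subset_carrier unfolding face_poly_ring_def by blast
  let ?g = "\<lambda>d. face_class (p d)"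
  have sub: "{d. ?g d \<noteq> \<zero>\<^bsub>?L\<^esub>} \<subseteq> {d. p d \<noteq> 0}"
    by (auto simp: zero_face_ring)
  have "x = finsum ?L ?g {d. p d \<noteq> 0}"
    using p_carrier by (simp add: f(2) p(3) comp_def Pi_def)
  also have "\<dots> = finsum ?L ?g {d. ?g d \<noteq> \<zero>\<^bsub>?L\<^esub>}"
    using p(2) sub p_carrier by (intro C.S.add.finprod_mono_neutral_cong_right) auto
  finally show ?thesis
    using p(1) finite_subset[OF sub p(2)] by (intro exI[of _ ?g]) (auto simp: piece_face_ring)
qed

text \<open>The projections carry a decomposition of \<open>x\<close> into the decompositions of its images in graded
  polynomial rings. As they are jointly injective, this makes the decomposition of \<open>x\<close> unique.\<close>

lemma face_ring_proj_component:
  assumes \<rho>: "\<rho> \<in> carrier S"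
    and f: "\<And>d. f d \<in> piece (face_ring S) d" "finite {d. f d \<noteq> \<zero>\<^bsub>face_ring S\<^esub>}"
  shows "face_ring_proj S \<rho> (f d) =
    hom_comp (\<lambda>_. 2) d (face_ring_proj S \<rho> (finsum (face_ring S) f {d. f d \<noteq> \<zero>\<^bsub>face_ring S\<^esub>}))"
proof -
  let ?p = "face_ring_proj S \<rho>" and ?Z = "simplex_poly_ring S \<rho>"
  have "cring ?Z"
    by (simp add: simplex_poly_ring_def cring_int_poly_ring)
  then interpret H: ring_hom_cring "face_ring S" ?Z ?p
    using face_ring_proj_graded_hom[OF \<rho>] cring_face_ring
    by (intro ring_hom_cring.intro ring_hom_cring_axioms.intro) (auto simp: graded_hom_def)
  have f_carrier: "f d \<in> carrier (face_ring S)" for d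
    using f(1) piece_face_ring_carrier by blast
  have piece: "?p (f d) \<in> piece (int_poly_ring (vertices S \<rho>) (\<lambda>_. 2)) d" for d
    using face_ring_proj_graded_hom[OF \<rho>] f(1)[of d]
    by (auto simp: graded_hom_def simplex_poly_ring_def)
  let ?D = "{d. f d \<noteq> \<zero>\<^bsub>face_ring S\<^esub>}"
  have "?p (finsum (face_ring S) f ?D) = finsum ?Z (?p \<circ> f) ?D"
    using f_carrier by (intro H.hom_finsum) simp
  also have "\<dots> = (\<Sum>d\<in>?D. ?p (f d))"
    unfolding simplex_poly_ring_def using subsetD[OF piece_subset_carrier piece]
    by (simp add: finsum_int_poly_ring)
  also have "hom_comp (\<lambda>_. 2) d \<dots> = ?p (f d)"
    using f(2) piece H.hom_zero
    by (intro hom_comp_sum_pieces[where X = "vertices S \<rho>"]) (auto simp: simplex_poly_ring_def)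
  finally show ?thesis
    by simp
qed

lemma is_graded_ring_face_ring: "is_graded_ring (face_ring S)"
proof -
  let ?L = "face_ring S"
  let ?dec = "\<lambda>x f. (\<forall>d. f d \<in> piece ?L d) \<and> finite {d. f d \<noteq> \<zero>\<^bsub>?L\<^esub>} \<and>
    x = finsum ?L f {d. f d \<noteq> \<zero>\<^bsub>?L\<^esub>}"
  have unique: "f d = g d" if f: "?dec x f" and g: "?dec x g" for x f g d
  proof (rule face_ring_proj_inject)
    show "f d \<in> carrier ?L" "g d \<in> carrier ?L"
      using f g piece_face_ring_carrier by blast+
    fix \<rho> assume "\<rho> \<in> carrier S"
    from face_ring_proj_component[OF this, of f d] face_ring_proj_component[OF this, of g d] f g
    show "face_ring_proj S \<rho> (f d) = face_ring_proj S \<rho> (g d)"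
      by simp
  qed
  have decomposition: "\<exists>!f. ?dec x f" if "x \<in> carrier ?L" for x
    using face_ring_decomposition_exists[OF that] unique by (intro ex_ex1I ext) blast+
  have one: "\<one>\<^bsub>?L\<^esub> \<in> piece ?L 0"
    by (simp add: one_face_ring piece_face_ring face_poly_ring_def piece_one)
  have mult: "x \<otimes>\<^bsub>?L\<^esub> y \<in> piece ?L (d + e)" if "x \<in> piece ?L d" "y \<in> piece ?L e" for x y d e
  proof -
    obtain f g where fg: "f \<in> piece (face_poly_ring S) d" "x = face_class f"
      "g \<in> piece (face_poly_ring S) e" "y = face_class g"
      using \<open>x \<in> piece ?L d\<close> \<open>y \<in> piece ?L e\<close> by (auto simp: piece_face_ring)
    then have "f \<in> carrier (face_poly_ring S)" "g \<in> carrier (face_poly_ring S)"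
      using piece_subset_carrier unfolding face_poly_ring_def by blast+
    with fg have "x \<otimes>\<^bsub>?L\<^esub> y = face_class (f * g)"
      by (simp add: face_class_mult)
    moreover have "f * g \<in> piece (face_poly_ring S) (d + e)"
      using fg unfolding face_poly_ring_def by (intro piece_mult)
    ultimately show ?thesis
      by (simp add: piece_face_ring)
  qed
  show ?thesis
    unfolding is_graded_ring_def
    by (intro conjI allI ballI cring_face_ring additive_subgroup_piece_face_ring decomposition one mult)
qed

section \<open>The universal property\<close>

lemma graded_functor_simplex_poly_ring:
  "graded_functor S (simplex_poly_ring S) (simplex_poly_restrict S)"
proof -
  have "simplex_poly_restrict S \<sigma> \<tau> \<in> graded_hom (simplex_poly_ring S \<tau>) (simplex_poly_ring S \<sigma>)" for \<sigma> \<tau>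
    unfolding simplex_poly_restrict_def simplex_poly_ring_def
    by (intro poly_subst_graded_hom) (auto intro: piece_var piece_zero)
  moreover have "simplex_poly_restrict S \<sigma> \<sigma> f = f" if "f \<in> carrier (simplex_poly_ring S \<sigma>)" for \<sigma> f
    using that
    by (intro poly_mapping_eqI)
      (auto simp: lookup_restrict simplex_poly_ring_def carrier_int_poly_ring in_keys_iff[of _ f])
  moreover have "simplex_poly_restrict S \<rho> \<sigma> (simplex_poly_restrict S \<sigma> \<tau> f) =
      simplex_poly_restrict S \<rho> \<tau> f"
    if "\<rho> \<in> carrier S" "\<sigma> \<in> carrier S" "\<rho> \<sqsubseteq> \<sigma>" for \<rho> \<sigma> \<tau> f
    using vertices_mono[OF that] by (intro poly_mapping_eqI) (auto simp: lookup_restrict)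
  ultimately show ?thesis
    by (simp add: graded_functor_def is_graded_ring_simplex_poly_ring)
qed

lemma graded_cone_face_ring:
  "graded_cone S (simplex_poly_ring S) (simplex_poly_restrict S) (face_ring S) (face_ring_proj S)"
  using is_graded_ring_face_ring face_ring_proj_graded_hom restrict_face_eval
  by (auto simp: graded_cone_def carrier_face_ring face_ring_proj_class)

text \<open>A cone assigns to \<open>x\<close> the compatible family of the \<open>q \<sigma> x\<close>, and \<open>u x\<close> is the class of its section.
  Since the projections of the face ring are jointly injective ring homomorphisms, \<open>u\<close> inherits
  from the \<open>q \<sigma>\<close> that it is a homomorphism, and it is the only one.\<close>

lemma face_ring_universal:
  assumes cone: "graded_cone S (simplex_poly_ring S) (simplex_poly_restrict S) R q"
  shows "\<exists>!u. u \<in> graded_hom R (face_ring S) \<inter> extensional (carrier R) \<and>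
    (\<forall>\<sigma>\<in>carrier S. \<forall>x\<in>carrier R. face_ring_proj S \<sigma> (u x) = q \<sigma> x)"
proof -
  let ?L = "face_ring S" and ?p = "face_ring_proj S"
  have R: "cring R" and piece_R: "\<And>d. piece R d \<subseteq> carrier R"
    using cone additive_subgroup.a_subset by (auto simp: graded_cone_def is_graded_ring_def)
  then interpret R: cring R
    by simp
  interpret L: cring ?L
    by (rule cring_face_ring)
  have q: "q \<sigma> \<in> ring_hom R (simplex_poly_ring S \<sigma>)"
    "\<And>d x. x \<in> piece R d \<Longrightarrow> q \<sigma> x \<in> piece (simplex_poly_ring S \<sigma>) d" if "\<sigma> \<in> carrier S" for \<sigma>
    using cone that by (auto simp: graded_cone_def graded_hom_def)
  have p: "?p \<sigma> \<in> ring_hom ?L (simplex_poly_ring S \<sigma>)" if "\<sigma> \<in> carrier S" for \<sigma>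
    using face_ring_proj_graded_hom[OF that] by (simp add: graded_hom_def)
  define u where "u = restrict (\<lambda>x. face_class (face_section (\<lambda>\<sigma>. q \<sigma> x))) (carrier R)"
  have u_carrier: "u x \<in> carrier ?L" if "x \<in> carrier R" for x
    using that by (simp add: u_def carrier_face_ring face_section_carrier)
  have p_u: "?p \<rho> (u x) = q \<rho> x" if \<rho>: "\<rho> \<in> carrier S" and x: "x \<in> carrier R" for \<rho> x
  proof -
    have "face_eval \<rho> (face_section (\<lambda>\<sigma>. q \<sigma> x)) = q \<rho> x"
    proof (rule face_eval_face_section[OF \<rho>])
      show "q \<rho> x \<in> carrier (simplex_poly_ring S \<rho>)"
        using ring_hom_closed[OF q(1)[OF \<rho>] x] .
      show "simplex_poly_restrict S \<sigma> \<rho> (q \<rho> x) = q \<sigma> x" if "\<sigma> \<in> carrier S" "\<sigma> \<sqsubseteq> \<rho>" for \<sigma>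
        using cone that \<rho> x by (simp add: graded_cone_def)
    qed
    with \<rho> x show ?thesis
      by (simp add: u_def face_ring_proj_class)
  qed
  have "u \<in> ring_hom R ?L"
  proof (rule ring_hom_memI)
    fix x y assume x: "x \<in> carrier R" and y: "y \<in> carrier R"
    show "u (x \<otimes>\<^bsub>R\<^esub> y) = u x \<otimes>\<^bsub>?L\<^esub> u y"
      using x y u_carrier
      by (intro face_ring_proj_inject)
        (simp_all add: p_u ring_hom_mult[OF q(1)] ring_hom_mult[OF p])
    show "u (x \<oplus>\<^bsub>R\<^esub> y) = u x \<oplus>\<^bsub>?L\<^esub> u y"
      using x y u_carrier
      by (intro face_ring_proj_inject)
        (simp_all add: p_u ring_hom_add[OF q(1)] ring_hom_add[OF p])
  next
    show "u \<one>\<^bsub>R\<^esub> = \<one>\<^bsub>?L\<^esub>"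
      using u_carrier
      by (intro face_ring_proj_inject) (simp_all add: p_u ring_hom_one[OF q(1)] ring_hom_one[OF p])
  qed (rule u_carrier)
  moreover have "u x \<in> piece ?L d" if x: "x \<in> piece R d" for x d
  proof -
    have "face_section (\<lambda>\<sigma>. q \<sigma> x) \<in> piece (face_poly_ring S) d"
      using q(2) x by (intro face_section_piece)
    with x piece_R show ?thesis
      by (auto simp: u_def piece_face_ring)
  qed
  ultimately have u_hom: "u \<in> graded_hom R ?L"
    by (auto simp: graded_hom_def)
  have u_ext: "u \<in> extensional (carrier R)"
    by (simp add: u_def)
  show ?thesis
  proof (rule ex1I[of _ u])
    fix u' assume u': "u' \<in> graded_hom R ?L \<inter> extensional (carrier R) \<and>
      (\<forall>\<sigma>\<in>carrier S. \<forall>x\<in>carrier R. ?p \<sigma> (u' x) = q \<sigma> x)"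
    show "u' = u"
    proof (rule extensionalityI)
      show "u' \<in> extensional (carrier R)" "u \<in> extensional (carrier R)"
        using u' u_ext by simp_all
      fix x assume x: "x \<in> carrier R"
      show "u' x = u x"
      proof (rule face_ring_proj_inject)
        show "u' x \<in> carrier ?L"
          using u' x ring_hom_closed[of u' R ?L x] by (simp add: graded_hom_def)
      qed (use u' x u_carrier p_u in simp_all)
    qed
  qed (use u_hom u_ext p_u in simp)
qed

end

theorem lemma2p5:
  fixes S :: "'a gorder"
  assumes "simplicial_poset S"
  shows "is_graded_limit TYPE('t) S (simplex_poly_ring S) (simplex_poly_restrict S)
           (face_ring S) (face_ring_proj S)"
proof -
  interpret simplicial_poset S
    by (rule assms)
  show ?thesis
    unfolding is_graded_limit_def
    by (intro conjI allI impI graded_functor_simplex_poly_ring graded_cone_face_ring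
        face_ring_universal)
qed

end
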